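(* Let $B\in\mathbb{DQ}^{m\times n}$ be a dual quaternion matrix with $B_{st}\ne O$. Then there exist a dual quaternion unitary matrix $\hat V\in\mathbb{DQ}^{m\times m}$ and a dual quaternion unitary matrix $\hat U\in\mathbb{DQ}^{n\times n}$ such that $$\hat V^*B\hat U=\begin{bmatrix}\Sigma_t&O\\O&O\end{bmatrix},$$ where $\Sigma_t\in\mathbb{D}^{t\times t}$ is a diagonal matrix of the form $$\Sigma_t={\rm diag}(\mu_1,\cdots,\mu_r,\cdots,\mu_t),$$ $r\le t\le\min\{m,n\}$, $\mu_1\ge\mu_2\ge\cdots\ge\mu_r$ are positive appreciable dual numbers, and $\mu_{r+1}\ge\cdots\ge\mu_t$ are positive infinitesimal dual numbers. Counting possible multiplicities of the diagonal entries, the form $\Sigma_t$ is unique.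
   Context: $\mathbb{Q}$ denotes the real quaternions and $q^*$ the quaternion conjugate. $\epsilon$ is the infinitesimal unit: $\epsilon\neq 0$, $\epsilon^2=0$, and $\epsilon$ commutes with all quaternions. A dual number is $q_{st}+q_{\mathcal I}\epsilon$ with $q_{st},q_{\mathcal I}\in\mathbb{R}$ (set $\mathbb{D}$); it is appreciable if $q_{st}\neq0$ and infinitesimal if $q_{st}=0$. A dual quaternion is $q=q_{st}+q_{\mathcal I}\epsilon$ with $q_{st},q_{\mathcal I}\in\mathbb{Q}$ (set $\mathbb{DQ}$), with conjugate $q^*=q_{st}^*+q_{\mathcal I}^*\epsilon$. A matrix over $\mathbb{DQ}$ is written $B=B_{st}+B_{\mathcal I}\epsilon$ with quaternion matrices $B_{st},B_{\mathcal I}$; $^*$ denotes conjugate transpose. A square matrix $U$ is unitary if $U^*U=I$. Zero blocks $O$ may be empty. Total order on dual numbers: $p\le q$ iff $p_{st}<q_{st}$, or $p_{st}=q_{st}$ and $p_{\mathcal I}\le q_{\mathcal I}$; positive means $>0$ in this order. *)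

theory Defs
  imports Complex_Main "Jordan_Normal_Form.Matrix"
begin

datatype quat = Quat (q_re: real) (q_i: real) (q_j: real) (q_k: real)

instantiation quat :: ring_1
begin

definition "0 = Quat 0 0 0 0"

definition "1 = Quat 1 0 0 0"

definition "p + q = Quat (q_re p + q_re q) (q_i p + q_i q) (q_j p + q_j q) (q_k p + q_k q)"

definition "p - q = Quat (q_re p - q_re q) (q_i p - q_i q) (q_j p - q_j q) (q_k p - q_k q)"

definition "- q = Quat (- q_re q) (- q_i q) (- q_j q) (- q_k q)"

text \<open>Hamilton's product: $i^2 = j^2 = k^2 = ijk = -1$.\<close>

definition "p * q = Quat
  (q_re p * q_re q - q_i p * q_i q - q_j p * q_j q - q_k p * q_k q)
  (q_re p * q_i q + q_i p * q_re q + q_j p * q_k q - q_k p * q_j q)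
  (q_re p * q_j q - q_i p * q_k q + q_j p * q_re q + q_k p * q_i q)
  (q_re p * q_k q + q_i p * q_j q - q_j p * q_i q + q_k p * q_re q)"

lemmas quat_ring_defs = zero_quat_def one_quat_def plus_quat_def minus_quat_def
  uminus_quat_def times_quat_def

instance
  by standard (simp_all add: quat_ring_defs algebra_simps)

end

text \<open>The real algebra structure makes \<open>of_real\<close> the embedding of the reals into the quaternions.\<close>

instantiation quat :: real_algebra_1
begin

definition "scaleR a q = Quat (a * q_re q) (a * q_i q) (a * q_j q) (a * q_k q)"

instance
  by standard (simp_all add: quat_ring_defs scaleR_quat_def algebra_simps)

end

definition quat_cnj :: "quat \<Rightarrow> quat" where
  "quat_cnj q = Quat (q_re q) (- q_i q) (- q_j q) (- q_k q)"


text \<open>\<open>Dual a b\<close> is $a + b\,\epsilon$ with $\epsilon^2 = 0$ and $\epsilon$ central. Dual numbers are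
  \<open>real dual\<close>, dual quaternions are \<open>quat dual\<close>.\<close>

datatype 'a dual = Dual (st_part: 'a) (inf_part: 'a)

instantiation dual :: (ring_1) ring_1
begin

definition "0 = Dual 0 0"

definition "1 = Dual 1 0"

definition "p + q = Dual (st_part p + st_part q) (inf_part p + inf_part q)"

definition "p - q = Dual (st_part p - st_part q) (inf_part p - inf_part q)"

definition "- q = Dual (- st_part q) (- inf_part q)"

definition "p * q = Dual (st_part p * st_part q) (st_part p * inf_part q + inf_part p * st_part q)"

lemmas dual_ring_defs = zero_dual_def one_dual_def plus_dual_def minus_dual_def
  uminus_dual_def times_dual_def

instance
  by standard (simp_all add: dual_ring_defs algebra_simps)

end

instantiation dual :: (linorder) linorder
begin

definition "p \<le> q \<longleftrightarrow>
  st_part p < st_part q \<or> st_part p = st_part q \<and> inf_part p \<le> inf_part q"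

definition "p < q \<longleftrightarrow>
  st_part p < st_part q \<or> st_part p = st_part q \<and> inf_part p < inf_part q"

instance
  by standard (auto simp: less_eq_dual_def less_dual_def intro: dual.expand)

end

definition appreciable :: "real dual \<Rightarrow> bool" where
  "appreciable p \<longleftrightarrow> st_part p \<noteq> 0"

definition infinitesimal :: "real dual \<Rightarrow> bool" where
  "infinitesimal p \<longleftrightarrow> st_part p = 0"

definition dq_of_dual :: "real dual \<Rightarrow> quat dual" where
  "dq_of_dual = map_dual of_real"

definition dq_cnj :: "quat dual \<Rightarrow> quat dual" where
  "dq_cnj = map_dual quat_cnj"


text \<open>The library's \<open>mat_adjoint\<close> is not available here: its class \<open>conjugatable_ring\<close> demands that
  conjugation preserve the order of factors, whereas quaternion conjugation reverses it.\<close>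

definition dq_adjoint :: "quat dual mat \<Rightarrow> quat dual mat" where
  "dq_adjoint A = map_mat dq_cnj (transpose_mat A)"

definition dq_unitary :: "nat \<Rightarrow> quat dual mat \<Rightarrow> bool" where
  "dq_unitary n U \<longleftrightarrow> U \<in> carrier_mat n n \<and> dq_adjoint U * U = 1\<^sub>m n"

text \<open>The $m \times n$ matrix with upper left block $\mathrm{diag}(\mu_1, \dots, \mu_t)$ and zero
  blocks elsewhere; $\mu_i$ is \<open>\<mu> (i - 1)\<close>. Meaningful for \<open>t \<le> min m n\<close> only.\<close>

definition sigma_block :: "nat \<Rightarrow> nat \<Rightarrow> nat \<Rightarrow> (nat \<Rightarrow> real dual) \<Rightarrow> quat dual mat" where
  "sigma_block m n t \<mu> = four_block_mat
     (map_mat dq_of_dual (mat_diag t \<mu>)) (0\<^sub>m t (n - t))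
     (0\<^sub>m (m - t) t)                      (0\<^sub>m (m - t) (n - t))"

definition singular_value_form ::
    "quat dual mat \<Rightarrow> quat dual mat \<Rightarrow> quat dual mat \<Rightarrow> nat \<Rightarrow> nat \<Rightarrow> (nat \<Rightarrow> real dual) \<Rightarrow> bool" where
  "singular_value_form B V U r t \<mu> \<longleftrightarrow>
     dq_unitary (dim_row B) V \<and> dq_unitary (dim_col B) U \<and>
     dq_adjoint V * B * U = sigma_block (dim_row B) (dim_col B) t \<mu> \<and>
     r \<le> t \<and> t \<le> min (dim_row B) (dim_col B) \<and>
     (\<forall>i<r. 0 < \<mu> i \<and> appreciable (\<mu> i)) \<and>
     (\<forall>i j. i \<le> j \<and> j < r \<longrightarrow> \<mu> j \<le> \<mu> i) \<and>
     (\<forall>i. r \<le> i \<and> i < t \<longrightarrow> 0 < \<mu> i \<and> infinitesimal (\<mu> i)) \<and>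
     (\<forall>i j. r \<le> i \<and> i \<le> j \<and> j < t \<longrightarrow> \<mu> j \<le> \<mu> i)"

end

theory Submission
  imports Defs "Jordan_Normal_Form.Spectral_Radius" "HOL-Combinatorics.List_Permutation"
begin

text \<open>
  Existence. Write \<open>B = A + E \<epsilon>\<close> and start from a quaternion singular value decomposition
  \<open>V\<^sup>* A U = \<Sigma>\<close>. Replacing \<open>V, U\<close> by \<open>V (I + \<epsilon> P), U (I + \<epsilon> Q)\<close> with anti-Hermitian \<open>P, Q\<close> changes
  the \<open>\<epsilon>\<close>-part \<open>C = V\<^sup>* E U\<close> into \<open>C + \<Sigma> Q - P \<Sigma>\<close>. This can be used to kill all entries of \<open>C\<close>
  between different singular values, and the anti-Hermitian part of each block belonging to a
  positive singular value. The remaining Hermitian blocks are diagonalised by the spectral theorem,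
  and the block of the singular value 0 by another singular value decomposition.

  Uniqueness. If \<open>V\<^sup>* \<Sigma> U = \<Sigma>'\<close>, then \<open>V \<Sigma>' = \<Sigma> U\<close> and \<open>U \<Sigma>'\<^sup>* = \<Sigma>\<^sup>* V\<close>, and comparing entries shows that
  \<open>\<mu>\<^sub>i = \<mu>'\<^sub>j\<close> whenever the entry \<open>U\<^sub>i\<^sub>j\<close> is appreciable. As the squared norms of the standard part of \<open>U\<close>
  form a doubly stochastic matrix, every value is attained equally often by \<open>\<mu>\<close> and \<open>\<mu>'\<close>.
\<close>

section \<open>Quaternion and dual quaternion matrices\<close>

definition qnorm2 :: "quat \<Rightarrow> real" where
  "qnorm2 q = (q_re q)\<^sup>2 + (q_i q)\<^sup>2 + (q_j q)\<^sup>2 + (q_k q)\<^sup>2"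

lemma quat_sel_arith [simp]:
  "q_re 0 = 0" "q_i 0 = 0" "q_j 0 = 0" "q_k 0 = 0"
  "q_re 1 = 1" "q_i 1 = 0" "q_j 1 = 0" "q_k 1 = 0"
  "q_re (p + q) = q_re p + q_re q" "q_i (p + q) = q_i p + q_i q"
  "q_j (p + q) = q_j p + q_j q" "q_k (p + q) = q_k p + q_k q"
  "q_re (p - q) = q_re p - q_re q" "q_i (p - q) = q_i p - q_i q"
  "q_j (p - q) = q_j p - q_j q" "q_k (p - q) = q_k p - q_k q"
  "q_re (- q) = - q_re q" "q_i (- q) = - q_i q"
  "q_j (- q) = - q_j q" "q_k (- q) = - q_k q"
  "q_re (a *\<^sub>R q) = a * q_re q" "q_i (a *\<^sub>R q) = a * q_i q"
  "q_j (a *\<^sub>R q) = a * q_j q" "q_k (a *\<^sub>R q) = a * q_k q"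
  "q_re (quat_cnj q) = q_re q" "q_i (quat_cnj q) = - q_i q"
  "q_j (quat_cnj q) = - q_j q" "q_k (quat_cnj q) = - q_k q"
  by (simp_all add: quat_ring_defs scaleR_quat_def quat_cnj_def)

lemma quat_sel_mult:
  "q_re (p * q) = q_re p * q_re q - q_i p * q_i q - q_j p * q_j q - q_k p * q_k q"
  "q_i (p * q) = q_re p * q_i q + q_i p * q_re q + q_j p * q_k q - q_k p * q_j q"
  "q_j (p * q) = q_re p * q_j q - q_i p * q_k q + q_j p * q_re q + q_k p * q_i q"
  "q_k (p * q) = q_re p * q_k q + q_i p * q_j q - q_j p * q_i q + q_k p * q_re q"
  by (simp_all add: quat_ring_defs)

lemma quat_sel_of_real [simp]:
  "q_re (of_real a) = a" "q_i (of_real a) = 0" "q_j (of_real a) = 0" "q_k (of_real a) = 0"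
  by (simp_all add: of_real_def)

lemma quat_sel_sum:
  "q_re (\<Sum>x\<in>A. f x) = (\<Sum>x\<in>A. q_re (f x))" "q_i (\<Sum>x\<in>A. f x) = (\<Sum>x\<in>A. q_i (f x))"
  "q_j (\<Sum>x\<in>A. f x) = (\<Sum>x\<in>A. q_j (f x))" "q_k (\<Sum>x\<in>A. f x) = (\<Sum>x\<in>A. q_k (f x))"
  by (induction A rule: infinite_finite_induct; simp)+

lemma quat_eq_iff: "p = q \<longleftrightarrow> q_re p = q_re q \<and> q_i p = q_i q \<and> q_j p = q_j q \<and> q_k p = q_k q"
  using quat.expand by blast

lemma quat_cnj_mult: "quat_cnj (p * q) = quat_cnj q * quat_cnj p"
  by (simp add: quat_eq_iff quat_sel_mult algebra_simps)

lemma quat_cnj_cnj [simp]: "quat_cnj (quat_cnj q) = q"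
  and quat_cnj_add: "quat_cnj (p + q) = quat_cnj p + quat_cnj q"
  and quat_cnj_of_real [simp]: "quat_cnj (of_real a) = of_real a"
  by (simp_all add: quat_eq_iff)

lemma quat_cnj_mult_self: "quat_cnj q * q = of_real (qnorm2 q)" "q * quat_cnj q = of_real (qnorm2 q)"
  by (simp_all add: quat_eq_iff quat_sel_mult qnorm2_def power2_eq_square algebra_simps)

lemma of_real_mult_quat: "of_real a * q = a *\<^sub>R (q :: quat)" "q * of_real a = a *\<^sub>R (q :: quat)"
  by (simp_all add: quat_eq_iff quat_sel_mult)

lemma qnorm2_ge_0 [simp]: "0 \<le> qnorm2 q"
  by (simp add: qnorm2_def)

lemma qnorm2_eq_0_iff [simp]: "qnorm2 q = 0 \<longleftrightarrow> q = 0"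
  by (auto simp: qnorm2_def quat_eq_iff add_nonneg_eq_0_iff)

lemma qnorm2_scaleR: "qnorm2 (a *\<^sub>R q) = a\<^sup>2 * qnorm2 q"
  by (simp add: qnorm2_def power_mult_distrib algebra_simps)

lemma q_re_mult_commute: "q_re (p * q) = q_re (q * p)"
  by (simp add: quat_sel_mult)

lemma index_mult_mat_sum:
  assumes "A \<in> carrier_mat n k" "B \<in> carrier_mat k m" "i < n" "j < m"
  shows "(A * B) $$ (i, j) = (\<Sum>l<k. A $$ (i, l) * B $$ (l, j))"
  using assms by (simp add: scalar_prod_def atLeast0LessThan)

locale ring_involution =
  fixes cnj :: "'a :: ring_1 \<Rightarrow> 'a"
  assumes cnj_add: "cnj (x + y) = cnj x + cnj y"
    and cnj_mult: "cnj (x * y) = cnj y * cnj x"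
    and cnj_cnj [simp]: "cnj (cnj x) = x"
begin

lemma cnj_0 [simp]: "cnj 0 = 0"
  using cnj_add[of 0 0] by simp

lemma cnj_1 [simp]: "cnj 1 = 1"
  using cnj_mult[of "cnj 1" 1] by simp

lemma cnj_minus: "cnj (- x) = - cnj x"
  using cnj_add[of x "- x"] by (simp add: eq_neg_iff_add_eq_0 add.commute)

lemma cnj_diff: "cnj (x - y) = cnj x - cnj y"
  using cnj_add[of x "- y"] by (simp add: cnj_minus)

lemma cnj_sum: "cnj (\<Sum>x\<in>A. f x) = (\<Sum>x\<in>A. cnj (f x))"
  by (induction A rule: infinite_finite_induct) (simp_all add: cnj_add)

definition adj :: "'a mat \<Rightarrow> 'a mat" where
  "adj A = map_mat cnj (transpose_mat A)"

definition unitary :: "nat \<Rightarrow> 'a mat \<Rightarrow> bool" where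
  "unitary n U \<longleftrightarrow> U \<in> carrier_mat n n \<and> adj U * U = 1\<^sub>m n"

lemma adj_carrier [simp, intro]: "A \<in> carrier_mat n m \<Longrightarrow> adj A \<in> carrier_mat m n"
  by (auto simp: adj_def)

lemma adj_dim [simp]: "dim_row (adj A) = dim_col A" "dim_col (adj A) = dim_row A"
  by (auto simp: adj_def)

lemma adj_index [simp]: "i < dim_col A \<Longrightarrow> j < dim_row A \<Longrightarrow> adj A $$ (i, j) = cnj (A $$ (j, i))"
  by (auto simp: adj_def)

lemma adj_adj [simp]: "adj (adj A) = A"
  by (intro eq_matI) auto

lemma adj_one [simp]: "adj (1\<^sub>m n) = 1\<^sub>m n"
  by (intro eq_matI) auto

lemma adj_mult:
  assumes A: "A \<in> carrier_mat n k" and B: "B \<in> carrier_mat k m"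
  shows "adj (A * B) = adj B * adj A"
proof (rule eq_matI)
  fix i j assume "i < dim_row (adj B * adj A)" "j < dim_col (adj B * adj A)"
  hence ij: "i < m" "j < n" using A B by auto
  have "adj (A * B) $$ (i, j) = cnj (\<Sum>l<k. A $$ (j, l) * B $$ (l, i))"
    using A B ij by (simp add: index_mult_mat_sum[OF A B] del: index_mult_mat(1))
  also have "\<dots> = (\<Sum>l<k. adj B $$ (i, l) * adj A $$ (l, j))"
    unfolding cnj_sum using A B ij by (intro sum.cong) (simp_all add: cnj_mult)
  also have "\<dots> = (adj B * adj A) $$ (i, j)"
    using index_mult_mat_sum[OF adj_carrier[OF B] adj_carrier[OF A] ij] by simp
  finally show "adj (A * B) $$ (i, j) = (adj B * adj A) $$ (i, j)" .
qed (use A B in auto)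

lemma unitary_carrier: "unitary n U \<Longrightarrow> U \<in> carrier_mat n n"
  by (simp add: unitary_def)

lemma unitary_one [simp]: "unitary n (1\<^sub>m n)"
  by (simp add: unitary_def)

lemma unitary_mult:
  assumes U: "unitary n U" and W: "unitary n W"
  shows "unitary n (U * W)"
proof -
  note c = unitary_carrier[OF U] unitary_carrier[OF W]
  have "adj (U * W) * (U * W) = adj W * (adj U * (U * W))"
    using c by (simp add: adj_mult[OF c] assoc_mult_mat[of _ n n _ n _ n])
  also have "adj U * (U * W) = (adj U * U) * W"
    using c by (subst assoc_mult_mat[of _ n n _ n _ n]) auto
  also have "\<dots> = W" using U c by (simp add: unitary_def)
  finally show ?thesis using W c by (simp add: unitary_def)
qed

lemma conj_mult_mult:
  assumes "V \<in> carrier_mat m m" "V' \<in> carrier_mat m m" "A \<in> carrier_mat m n"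
    "U \<in> carrier_mat n n" "U' \<in> carrier_mat n n"
  shows "adj (V * V') * A * (U * U') = adj V' * (adj V * A * U) * U'"
proof -
  have c: "adj V \<in> carrier_mat m m" "adj V' \<in> carrier_mat m m" using assms by auto
  have assoc: "X * Y * A * (U * U') = X * (Y * A * U) * U'"
    if "X \<in> carrier_mat m m" "Y \<in> carrier_mat m m" for X Y
    using assms that by (simp add: assoc_mult_mat[of _ m m _ m _ n]
      assoc_mult_mat[of _ m m _ n _ n] assoc_mult_mat[of _ m n _ n _ n])
  show ?thesis
    using assoc[OF c(2,1)] by (simp add: adj_mult[OF assms(1,2)])
qed

lemma adj_conj:
  assumes "V \<in> carrier_mat m m" "A \<in> carrier_mat m n" "U \<in> carrier_mat n n"
  shows "adj (adj V * A * U) = adj U * adj A * V"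
proof -
  have "adj (adj V * A * U) = adj U * (adj A * V)"
    using assms by (subst adj_mult[of _ m n _ n], simp_all)
      (auto simp: adj_mult[of _ m m _ n] intro: carrier_matI)
  thus ?thesis using assms by (subst assoc_mult_mat[of _ n n _ m _ m]) auto
qed

lemma unitaryI:
  assumes "U \<in> carrier_mat n n"
    and "\<And>i j. i < n \<Longrightarrow> j < n \<Longrightarrow>
      (\<Sum>l<n. cnj (U $$ (l, i)) * U $$ (l, j)) = (if i = j then 1 else 0)"
  shows "unitary n U"
  unfolding unitary_def
proof (intro conjI eq_matI)
  fix i j assume "i < dim_row (1\<^sub>m n :: 'a mat)" "j < dim_col (1\<^sub>m n :: 'a mat)"
  hence ij: "i < n" "j < n" by auto
  have "(adj U * U) $$ (i, j) = (\<Sum>l<n. adj U $$ (i, l) * U $$ (l, j))"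
    using assms(1) ij by (intro index_mult_mat_sum[of _ n n _ n]) auto
  also have "\<dots> = (\<Sum>l<n. cnj (U $$ (l, i)) * U $$ (l, j))"
    using assms(1) ij by (intro sum.cong) auto
  finally show "(adj U * U) $$ (i, j) = 1\<^sub>m n $$ (i, j)"
    using assms(2)[OF ij] ij by simp
qed (use assms(1) in auto)

lemma unitary_sum:
  assumes U: "unitary n U" and ij: "i < n" "j < n"
  shows "(\<Sum>l<n. cnj (U $$ (l, i)) * U $$ (l, j)) = (if i = j then 1 else 0)"
proof -
  note c = unitary_carrier[OF U]
  have "(adj U * U) $$ (i, j) = (\<Sum>l<n. adj U $$ (i, l) * U $$ (l, j))"
    using c ij by (intro index_mult_mat_sum[of _ n n _ n]) auto
  also have "\<dots> = (\<Sum>l<n. cnj (U $$ (l, i)) * U $$ (l, j))"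
    using c ij by (intro sum.cong) auto
  finally show ?thesis using U ij by (simp add: unitary_def)
qed

lemma conj_index:
  assumes "V \<in> carrier_mat m m" "A \<in> carrier_mat m n" "U \<in> carrier_mat n n" "i < m" "j < n"
  shows "(adj V * A * U) $$ (i, j)
    = (\<Sum>k<m. \<Sum>l<n. cnj (V $$ (k, i)) * A $$ (k, l) * U $$ (l, j))"
proof -
  have "(adj V * A * U) $$ (i, j) = (\<Sum>l<n. (adj V * A) $$ (i, l) * U $$ (l, j))"
    using assms by (intro index_mult_mat_sum[of _ m n _ n]) auto
  also have "\<dots> = (\<Sum>l<n. (\<Sum>k<m. cnj (V $$ (k, i)) * A $$ (k, l)) * U $$ (l, j))"
    using assms by (intro sum.cong refl arg_cong2[where f="(*)"], subst index_mult_mat_sum[of _ m m _ n]) auto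
  also have "\<dots> = (\<Sum>l<n. \<Sum>k<m. cnj (V $$ (k, i)) * A $$ (k, l) * U $$ (l, j))"
    by (simp add: sum_distrib_right)
  finally show ?thesis by (subst sum.swap)
qed

lemma perm_mat_unitary:
  assumes p: "p permutes {..<n}"
  shows "unitary n (mat n n (\<lambda>(i, j). if i = p j then 1 else 0))"
proof (rule unitaryI)
  fix i j assume ij: "i < n" "j < n"
  hence pi: "p i < n" using permutes_in_image[OF p, of i] by simp
  have "(\<Sum>l<n. cnj (mat n n (\<lambda>(i, j). if i = p j then 1 else 0) $$ (l, i)) *
      mat n n (\<lambda>(i, j). if i = p j then 1 else 0) $$ (l, j))
    = (\<Sum>l<n. if l = p i then if p i = p j then 1 else 0 else 0)"
    using ij by (intro sum.cong) auto
  also have "\<dots> = (if i = j then 1 else 0)"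
    using pi permutes_inj[OF p] by (auto dest: injD)
  finally show "(\<Sum>l<n. cnj (mat n n (\<lambda>(i, j). if i = p j then 1 else 0) $$ (l, i)) *
      mat n n (\<lambda>(i, j). if i = p j then 1 else 0) $$ (l, j)) = (if i = j then 1 else 0)" .
qed auto

lemma conj_perm_mat:
  assumes p: "p permutes {..<m}" and q: "q permutes {..<n}"
    and A: "A \<in> carrier_mat m n" and ij: "i < m" "j < n"
  shows "(adj (mat m m (\<lambda>(i, j). if i = p j then 1 else 0)) * A
    * mat n n (\<lambda>(i, j). if i = q j then 1 else 0)) $$ (i, j) = A $$ (p i, q j)"
proof -
  have pi: "p i < m" using permutes_in_image[OF p, of i] ij by simp
  have qj: "q j < n" using permutes_in_image[OF q, of j] ij by simp
  show ?thesis
  proof (subst conj_index[OF _ A _ ij])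
    have "(\<Sum>k<m. \<Sum>l<n. cnj (mat m m (\<lambda>(i, j). if i = p j then 1 else 0) $$ (k, i)) *
        A $$ (k, l) * mat n n (\<lambda>(i, j). if i = q j then 1 else 0) $$ (l, j))
      = (\<Sum>k<m. \<Sum>l<n. if l = q j then if k = p i then A $$ (p i, q j) else 0 else 0)"
      using ij by (intro sum.cong refl) auto
    also have "\<dots> = A $$ (p i, q j)" using pi qj by simp
    finally show "(\<Sum>k<m. \<Sum>l<n. cnj (mat m m (\<lambda>(i, j). if i = p j then 1 else 0) $$ (k, i)) *
        A $$ (k, l) * mat n n (\<lambda>(i, j). if i = q j then 1 else 0) $$ (l, j)) = A $$ (p i, q j)" .
  qed auto
qed

end

interpretation quat: ring_involution quat_cnj
  by standard (simp_all add: quat_cnj_add quat_cnj_mult)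

lemma dual_eq_iff: "x = y \<longleftrightarrow> st_part x = st_part y \<and> inf_part x = inf_part y"
  using dual.expand by blast

lemma dual_sel_arith [simp]:
  "st_part 0 = 0" "inf_part 0 = 0" "st_part 1 = 1" "inf_part 1 = 0"
  "st_part (p + q) = st_part p + st_part q" "inf_part (p + q) = inf_part p + inf_part q"
  "st_part (p - q) = st_part p - st_part q" "inf_part (p - q) = inf_part p - inf_part q"
  "st_part (- q) = - st_part q" "inf_part (- q) = - inf_part q"
  "st_part (p * q) = st_part p * st_part q"
  "inf_part (p * q) = st_part p * inf_part q + inf_part p * st_part q"
  by (simp_all add: dual_ring_defs)

lemma dual_sel_sum:
  "st_part (\<Sum>x\<in>A. f x) = (\<Sum>x\<in>A. st_part (f x))"
  "inf_part (\<Sum>x\<in>A. f x) = (\<Sum>x\<in>A. inf_part (f x))"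
  by (induction A rule: infinite_finite_induct; simp)+

lemma dq_cnj_sel [simp]:
  "st_part (dq_cnj q) = quat_cnj (st_part q)" "inf_part (dq_cnj q) = quat_cnj (inf_part q)"
  by (simp_all add: dq_cnj_def dual.map_sel)

interpretation dq: ring_involution dq_cnj
  by standard (simp_all add: dual_eq_iff quat_cnj_add quat_cnj_mult)

lemma dq_adjoint_eq: "dq_adjoint = dq.adj"
  by (simp add: fun_eq_iff dq_adjoint_def dq.adj_def)

lemma dq_unitary_eq: "dq_unitary = dq.unitary"
  by (simp add: fun_eq_iff dq_unitary_def dq.unitary_def dq_adjoint_eq)

text \<open>A Hermitian idempotent whose trace has real part 0 vanishes; \<open>I - U U\<^sup>*\<close> is one, since the
  real part of the trace is cyclic.\<close>

lemma quat_unitary_adj: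
  assumes U: "quat.unitary n U"
  shows "quat.unitary n (quat.adj U)"
proof -
  note c = quat.unitary_carrier[OF U]
  define E where "E = U * quat.adj U"
  have Ec: "E \<in> carrier_mat n n" using c by (auto simp: E_def)
  have E_ij: "E $$ (i, j) = (\<Sum>l<n. U $$ (i, l) * quat_cnj (U $$ (j, l)))" if "i < n" "j < n" for i j
    unfolding E_def using c that
    by (subst index_mult_mat_sum[OF c quat.adj_carrier[OF c]]) auto
  have E_herm: "quat_cnj (E $$ (i, j)) = E $$ (j, i)" if "i < n" "j < n" for i j
    using that by (simp add: E_ij quat.cnj_sum quat_cnj_mult)
  have "E * E = U * (quat.adj U * (U * quat.adj U))"
    unfolding E_def using c by (simp add: assoc_mult_mat[of _ n n _ n _ n])
  also have "quat.adj U * (U * quat.adj U) = quat.adj U * U * quat.adj U"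
    using c by (subst assoc_mult_mat[of _ n n _ n _ n]) auto
  also have "\<dots> = quat.adj U" using U c by (simp add: quat.unitary_def)
  finally have EE: "E * E = E" by (simp add: E_def)
  have E2: "(\<Sum>j<n. E $$ (i, j) * E $$ (j, i)) = E $$ (i, i)" if "i < n" for i
    using index_mult_mat_sum[OF Ec Ec that that] EE by simp
  have tr: "(\<Sum>i<n. q_re (E $$ (i, i))) = n"
  proof -
    have "(\<Sum>i<n. q_re (E $$ (i, i))) = (\<Sum>i<n. \<Sum>l<n. q_re (U $$ (i, l) * quat_cnj (U $$ (i, l))))"
      by (simp add: E_ij quat_sel_sum)
    also have "\<dots> = (\<Sum>l<n. q_re (\<Sum>i<n. quat_cnj (U $$ (i, l)) * U $$ (i, l)))"
      by (subst sum.swap) (simp add: quat_sel_sum q_re_mult_commute)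
    also have "\<dots> = n" by (simp add: quat.unitary_sum[OF U])
    finally show ?thesis .
  qed
  define D where "D i j = (if i = j then 1 else 0) - E $$ (i, j)" for i j
  have "(\<Sum>i<n. \<Sum>j<n. qnorm2 (D i j)) = 0"
  proof -
    have "(\<Sum>j<n. qnorm2 (D i j)) = 1 - q_re (E $$ (i, i))" if i: "i < n" for i
    proof -
      have "of_real (\<Sum>j<n. qnorm2 (D i j)) = (\<Sum>j<n. D i j * quat_cnj (D i j))"
        by (simp add: quat_cnj_mult_self)
      also have "\<dots> = (\<Sum>j<n. (if i = j then 1 - E $$ (i, i) - E $$ (i, i) else 0)
          + E $$ (i, j) * E $$ (j, i))"
        using i by (intro sum.cong) (auto simp: D_def quat.cnj_diff E_herm algebra_simps)
      also have "\<dots> = 1 - E $$ (i, i)"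
        using i by (simp add: sum.distrib E2)
      finally show ?thesis by (metis quat_sel_of_real(1) quat_sel_arith(5,13))
    qed
    hence "(\<Sum>i<n. \<Sum>j<n. qnorm2 (D i j)) = (\<Sum>i<n. 1 - q_re (E $$ (i, i)))" by simp
    thus ?thesis using tr by (simp add: sum_subtractf)
  qed
  hence "D i j = 0" if "i < n" "j < n" for i j
    using that by (simp add: sum_nonneg_eq_0_iff sum_nonneg)
  hence "E = 1\<^sub>m n" using Ec by (intro eq_matI) (auto simp: D_def)
  thus ?thesis using c by (simp add: quat.unitary_def E_def)
qed

section \<open>Eigenvectors of Hermitian quaternion matrices\<close>

lemma complex_eigenvector_exists:
  fixes M :: "nat \<Rightarrow> nat \<Rightarrow> complex"
  assumes "N > 0"
  obtains v k where "\<exists>i<N. v i \<noteq> 0" "\<And>i. i < N \<Longrightarrow> (\<Sum>j<N. M i j * v j) = k * v i"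
proof -
  have A: "mat N N (\<lambda>(i, j). M i j) \<in> carrier_mat N N" by simp
  obtain k v where "eigenvector (mat N N (\<lambda>(i, j). M i j)) v k"
    using spectrum_non_empty[OF A assms] by (auto simp: spectrum_def eigenvalue_def)
  hence v: "v \<in> carrier_vec N" "v \<noteq> 0\<^sub>v N"
    and eq: "mat N N (\<lambda>(i, j). M i j) *\<^sub>v v = k \<cdot>\<^sub>v v"
    by (auto simp: eigenvector_def)
  have "\<exists>i<N. v $ i \<noteq> 0" using v by (auto simp: vec_eq_iff)
  moreover have "(\<Sum>j<N. M i j * v $ j) = k * v $ i" if "i < N" for i
    using arg_cong[OF eq, of "\<lambda>w. w $ i"] that v(1)
    by (simp add: scalar_prod_def atLeast0LessThan)
  ultimately show thesis using that[of "\<lambda>i. v $ i"] by blast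
qed

lemma sum_lessThan_double: "(\<Sum>j<2 * n. f j) = (\<Sum>j<n. f j + (f (n + j) :: 'a :: comm_monoid_add))"
  for n :: nat
proof -
  have "(\<Sum>j<2 * n. f j) = (\<Sum>j<n. f j) + (\<Sum>j=n..<n + n. f j)"
    by (simp add: mult_2 sum.atLeastLessThan_concat flip: atLeast0LessThan)
  also have "(\<Sum>j=n..<n + n. f j) = (\<Sum>j<n. f (n + j))"
    using sum.shift_bounds_nat_ivl[of f 0 n n] by (simp add: atLeast0LessThan add.commute)
  finally show ?thesis by (simp add: sum.distrib)
qed

text \<open>Writing quaternions as \<open>a + j b\<close> with complex \<open>a, b\<close>, left multiplication by a quaternion
  matrix becomes multiplication by a complex matrix of twice the size, commuting with right
  multiplication by complex numbers.\<close>

lemma quat_right_eigenvector: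
  fixes T :: "nat \<Rightarrow> nat \<Rightarrow> quat"
  assumes n: "n > 0"
  obtains x k where "\<exists>i<n. x i \<noteq> 0" "\<And>i. i < n \<Longrightarrow> (\<Sum>j<n. T i j * x j) = x i * k"
proof -
  define c1 where "c1 q = Complex (q_re q) (q_i q)" for q
  define c2 where "c2 q = Complex (q_j q) (- q_k q)" for q
  define Q where "Q a b = Quat (Re a) (Im a) (Re b) (- Im b)" for a b
  define M where "M i j = (if i < n then if j < n then c1 (T i j) else - cnj (c2 (T i (j - n)))
    else if j < n then c2 (T (i - n) j) else cnj (c1 (T (i - n) (j - n))))" for i j
  obtain v k where v: "\<exists>i<2 * n. v i \<noteq> 0"
    and eq: "\<And>i. i < 2 * n \<Longrightarrow> (\<Sum>j<2 * n. M i j * v j) = k * v i"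
    using complex_eigenvector_exists[of "2 * n" M] n by auto
  define x where "x i = Q (v i) (v (n + i))" for i
  have "\<exists>i<n. x i \<noteq> 0"
  proof -
    from v obtain i where i: "i < 2 * n" "v i \<noteq> 0" by blast
    have "x (if i < n then i else i - n) \<noteq> 0"
      using i(2) by (auto simp: x_def Q_def zero_quat_def complex_eq_iff)
    thus ?thesis using i(1) by (intro exI[of _ "if i < n then i else i - n"]) auto
  qed
  moreover have "(\<Sum>j<n. T i j * x j) = x i * Q k 0" if i: "i < n" for i
  proof -
    have Q_add: "Q (\<Sum>j\<in>A. f j) (\<Sum>j\<in>A. g j) = (\<Sum>j\<in>A. Q (f j) (g j))" for f g and A :: "nat set"
      by (simp add: Q_def quat_eq_iff quat_sel_sum sum_negf)
    have "(\<Sum>j<n. T i j * x j) = (\<Sum>j<n. Q (M i j * v j + M i (n + j) * v (n + j))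
        (M (n + i) j * v j + M (n + i) (n + j) * v (n + j)))"
      using i by (intro sum.cong refl)
        (simp add: M_def x_def Q_def c1_def c2_def quat_eq_iff quat_sel_mult algebra_simps)
    also have "\<dots> = Q (\<Sum>j<2 * n. M i j * v j) (\<Sum>j<2 * n. M (n + i) j * v j)"
      by (simp only: Q_add sum_lessThan_double)
    also have "\<dots> = Q (k * v i) (k * v (n + i))" using i eq by simp
    also have "\<dots> = x i * Q k 0"
      by (simp add: x_def Q_def quat_eq_iff quat_sel_mult algebra_simps)
    finally show ?thesis .
  qed
  ultimately show thesis using that by blast
qed

lemma hermitian_eigenvector:
  fixes T :: "nat \<Rightarrow> nat \<Rightarrow> quat"
  assumes I: "finite I" "I \<noteq> {}"
    and T: "\<And>i j. i \<in> I \<Longrightarrow> j \<in> I \<Longrightarrow> quat_cnj (T i j) = T j i"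
  obtains x a where "(\<Sum>i\<in>I. qnorm2 (x i)) = 1" "\<And>i. i \<notin> I \<Longrightarrow> x i = 0"
    "\<And>i. i \<in> I \<Longrightarrow> (\<Sum>j\<in>I. T i j * x j) = a *\<^sub>R x i"
proof -
  obtain h where h: "bij_betw h {..<card I} I"
    using ex_bij_betw_nat_finite[OF I(1)] by (auto simp: atLeast0LessThan)
  have "card I > 0" using I by (simp add: card_gt_0_iff)
  then obtain y q where y: "\<exists>i<card I. y i \<noteq> 0"
    and eq: "\<And>i. i < card I \<Longrightarrow> (\<Sum>j<card I. T (h i) (h j) * y j) = y i * q"
    using quat_right_eigenvector[of "card I" "\<lambda>i j. T (h i) (h j)"] by blast
  define z where "z i = y (the_inv_into {..<card I} h i)" for i
  have inj: "inj_on h {..<card I}" and hI: "h ` {..<card I} = I"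
    using h by (auto simp: bij_betw_def)
  have zh: "z (h i) = y i" if "i < card I" for i
    using that inj by (simp add: z_def the_inv_into_f_f)
  have zeq: "(\<Sum>j\<in>I. T i j * z j) = z i * q" if "i \<in> I" for i
  proof -
    from that hI obtain l where l: "l < card I" "i = h l" by auto
    have "(\<Sum>j\<in>I. T i j * z j) = (\<Sum>j<card I. T i (h j) * z (h j))"
      by (rule sum.reindex_bij_betw[OF h, symmetric])
    thus ?thesis using l eq[OF l(1)] by (simp add: zh)
  qed
  define s where "s = (\<Sum>i\<in>I. qnorm2 (z i))"
  have "\<exists>i\<in>I. z i \<noteq> 0" using y zh hI by force
  hence s: "s > 0"
    unfolding s_def using I by (metis qnorm2_eq_0_iff qnorm2_ge_0 less_eq_real_def sum_pos2)
  have "of_real s * q = (\<Sum>i\<in>I. quat_cnj (z i) * (\<Sum>j\<in>I. T i j * z j))"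
    by (simp add: s_def sum_distrib_right zeq flip: quat_cnj_mult_self(1)  mult.assoc)
  hence sq: "of_real s * q = (\<Sum>i\<in>I. \<Sum>j\<in>I. quat_cnj (z i) * T i j * z j)"
    by (simp add: sum_distrib_left mult.assoc)
  have "quat_cnj (of_real s * q) = (\<Sum>i\<in>I. \<Sum>j\<in>I. quat_cnj (z j) * T j i * z i)"
    unfolding sq by (simp add: quat.cnj_sum quat_cnj_mult mult.assoc T cong: sum.cong)
  also have "\<dots> = of_real s * q" unfolding sq by (rule sum.swap)
  finally have "q_i q = 0 \<and> q_j q = 0 \<and> q_k q = 0"
    using s by (simp add: of_real_mult_quat quat_eq_iff)
  hence q: "q = of_real (q_re q)" by (simp add: quat_eq_iff)
  define x where "x i = (if i \<in> I then (1 / sqrt s) *\<^sub>R z i else 0)" for i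
  show thesis
  proof
    show "(\<Sum>i\<in>I. qnorm2 (x i)) = 1"
      using s by (simp add: x_def qnorm2_scaleR power_divide s_def[symmetric] flip: sum_divide_distrib)
    show "(\<Sum>j\<in>I. T i j * x j) = q_re q *\<^sub>R x i" if "i \<in> I" for i
    proof -
      have "(\<Sum>j\<in>I. T i j * x j) = (1 / sqrt s) *\<^sub>R (\<Sum>j\<in>I. T i j * z j)"
        by (simp add: x_def scaleR_sum_right)
      also have "(\<Sum>j\<in>I. T i j * z j) = q_re q *\<^sub>R z i"
        using zeq[OF that] q by (metis of_real_mult_quat(2))
      finally show ?thesis using that by (simp add: x_def)
    qed
  qed (simp add: x_def)
qed

text \<open>A reflection-like unitary \<open>I - w g w\<^sup>*\<close> with \<open>w = e\<^sub>k - x\<close>; \<open>g\<close> is chosen such that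
  \<open>w\<^sup>* e\<^sub>k = g\<^sup>-\<^sup>1\<close>. If \<open>x\<^sub>k = 1\<close> then \<open>w = 0\<close>, and the junk value \<open>g = 0\<close> does no harm.\<close>

lemma unitary_with_column:
  assumes I: "I \<subseteq> {..<n}" "k \<in> I"
    and x: "(\<Sum>i\<in>I. qnorm2 (x i)) = 1" "\<And>i. i \<notin> I \<Longrightarrow> x i = 0"
  obtains G where "quat.unitary n G" "\<And>i. i < n \<Longrightarrow> G $$ (i, k) = x i"
    "\<And>i j. i < n \<Longrightarrow> j < n \<Longrightarrow> i \<notin> I \<or> j \<notin> I \<Longrightarrow> G $$ (i, j) = (if i = j then 1 else 0)"
proof -
  have k: "k < n" using I by auto
  define \<delta> where "\<delta> i j = (if i = j then 1 else 0 :: quat)" for i j :: nat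
  define w where "w i = \<delta> i k - x i" for i
  define g where "g = (1 / qnorm2 (1 - x k)) *\<^sub>R (1 - x k)"
  define G where "G = mat n n (\<lambda>(i, j). \<delta> i j - w i * g * quat_cnj (w j))"
  have xn: "(\<Sum>i<n. qnorm2 (x i)) = 1"
    using x I(1) by (subst sum.mono_neutral_right[of _ I]) auto
  have w_norm: "(\<Sum>i<n. quat_cnj (w i) * w i) = of_real (2 - 2 * q_re (x k))"
  proof -
    have "(\<Sum>i<n. qnorm2 (w i)) = (\<Sum>i<n. qnorm2 (x i) + (if i = k then 1 - 2 * q_re (x k) else 0))"
      by (intro sum.cong) (auto simp: w_def \<delta>_def qnorm2_def power2_eq_square algebra_simps)
    also have "\<dots> = 2 - 2 * q_re (x k)" using k xn by (simp add: sum.distrib)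
    finally show ?thesis by (simp add: quat_cnj_mult_self flip: of_real_sum)
  qed
  have g: "g + quat_cnj g = quat_cnj g * (of_real (2 - 2 * q_re (x k)) * g)"
  proof -
    have "quat_cnj g * (c *\<^sub>R g) = of_real (c * qnorm2 g)" for c :: real
      by (simp add: quat_cnj_mult_self(1) of_real_def)
    moreover have c: "(2 - 2 * q_re (x k)) * qnorm2 g = 2 * q_re g"
      by (simp add: g_def qnorm2_scaleR power2_eq_square)
    ultimately have "quat_cnj g * ((2 - 2 * q_re (x k)) *\<^sub>R g) = of_real (2 * q_re g)"
      by (simp only: c)
    also have "\<dots> = g + quat_cnj g" by (simp add: quat_eq_iff del: of_real_mult)
    finally show ?thesis by (simp only: of_real_mult_quat(1))
  qed
  have G_ij: "G $$ (i, j) = \<delta> i j - w i * g * quat_cnj (w j)" if "i < n" "j < n" for i j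
    using that by (simp add: G_def)
  have x1: "w i = 0" if "i < n" "qnorm2 (1 - x k) = 0" for i
  proof -
    have "(\<Sum>i<n. qnorm2 (w i)) = 0"
      using w_norm that(2) by (simp add: quat_cnj_mult_self quat_eq_iff flip: of_real_sum)
    thus ?thesis using that by (simp add: sum_nonneg_eq_0_iff)
  qed
  show thesis
  proof
    show "quat.unitary n G"
    proof (rule quat.unitaryI)
      fix i j assume ij: "i < n" "j < n"
      have "(\<Sum>l<n. quat_cnj (G $$ (l, i)) * G $$ (l, j))
        = (\<Sum>l<n. (\<delta> l i - w i * quat_cnj g * quat_cnj (w l)) * (\<delta> l j - w l * g * quat_cnj (w j)))"
        using ij by (intro sum.cong) (auto simp: G_ij quat.cnj_diff quat_cnj_mult \<delta>_def mult.assoc)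
      also have "\<dots> = (\<Sum>l<n. (if l = i then \<delta> i j - w i * g * quat_cnj (w j) else 0)
        - (if l = j then w i * quat_cnj g * quat_cnj (w j) else 0)
        + w i * quat_cnj g * (quat_cnj (w l) * w l) * g * quat_cnj (w j))"
        by (intro sum.cong) (auto simp: \<delta>_def algebra_simps)
      also have "\<dots> = \<delta> i j - w i * (g + quat_cnj g) * quat_cnj (w j)
        + w i * quat_cnj g * (\<Sum>l<n. quat_cnj (w l) * w l) * g * quat_cnj (w j)"
        using ij by (simp add: sum.distrib sum_subtractf sum_distrib_left sum_distrib_right algebra_simps)
      also have "\<dots> = \<delta> i j"
        unfolding w_norm g by (simp add: mult.assoc)
      finally show "(\<Sum>l<n. quat_cnj (G $$ (l, i)) * G $$ (l, j)) = (if i = j then 1 else 0)"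
        by (simp add: \<delta>_def)
    qed (simp add: G_def)
    show "G $$ (i, k) = x i" if i: "i < n" for i
    proof (cases "qnorm2 (1 - x k) = 0")
      case True
      thus ?thesis using x1[OF i] i k by (simp add: G_ij) (simp add: w_def)
    next
      case False
      have "g * quat_cnj (w k) = 1"
      proof -
        have "g * quat_cnj (w k) = (1 / qnorm2 (1 - x k)) *\<^sub>R ((1 - x k) * quat_cnj (1 - x k))"
          by (simp only: g_def w_def \<delta>_def if_True simp_thms mult_scaleR_left)
        thus ?thesis using False by (simp only: quat_cnj_mult_self(2)) (simp add: of_real_def)
      qed
      thus ?thesis using i k by (simp add: G_ij mult.assoc) (simp add: w_def)
    qed
    show "G $$ (i, j) = (if i = j then 1 else 0)"
      if ij: "i < n" "j < n" "i \<notin> I \<or> j \<notin> I" for i j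
    proof -
      have "w i = 0 \<or> w j = 0" using ij(3) I(2) x(2) by (auto simp: w_def \<delta>_def)
      thus ?thesis using ij by (auto simp: G_ij) (auto simp: \<delta>_def)
    qed
  qed
qed

section \<open>Quaternion spectral theorem\<close>

lemma quat_spectral_blocks:
  assumes "T \<in> carrier_mat n n" "quat.adj T = T"
    and "\<forall>i<n. \<forall>j<n. T $$ (i, j) \<noteq> 0 \<longrightarrow> d i = d j"
  shows "\<exists>W. quat.unitary n W \<and> (\<forall>i<n. \<forall>j<n. W $$ (i, j) \<noteq> 0 \<longrightarrow> d i = d j) \<and>
    (\<forall>i<n. (\<forall>j<n. j \<noteq> i \<longrightarrow> T $$ (i, j) = 0) \<longrightarrow>
      (\<forall>j<n. W $$ (i, j) = (if i = j then 1 else 0) \<and> W $$ (j, i) = (if i = j then 1 else 0))) \<and>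
    (\<forall>i<n. \<forall>j<n. i \<noteq> j \<longrightarrow> (quat.adj W * T * W) $$ (i, j) = 0)"
  using assms
proof (induction "card {i. i < n \<and> \<not> (\<forall>j<n. j \<noteq> i \<longrightarrow> T $$ (i, j) = 0)}"
    arbitrary: T rule: less_induct)
  case less
  note T = less.prems(1) and herm = less.prems(2) and blk = less.prems(3)
  define dn where "dn A i \<longleftrightarrow> (\<forall>j<n. j \<noteq> i \<longrightarrow> A $$ (i, j) = 0)" for A :: "quat mat" and i
  have sym: "quat_cnj (T $$ (i, j)) = T $$ (j, i)" if "i < n" "j < n" for i j
    using quat.adj_index[of j T i] that T by (simp add: herm)
  show ?case
  proof (cases "\<forall>i<n. dn T i")
    case True
    have "\<forall>i<n. \<forall>j<n. i \<noteq> j \<longrightarrow> (quat.adj (1\<^sub>m n) * T * 1\<^sub>m n) $$ (i, j) = 0"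
      using True T by (auto simp: dn_def)
    thus ?thesis by (intro exI[of _ "1\<^sub>m n"]) auto
  next
    case False
    then obtain k where k: "k < n" "\<not> dn T k" by blast
    define I where "I = {i. i < n \<and> \<not> dn T i \<and> d i = d k}"
    have I: "I \<subseteq> {..<n}" "k \<in> I" using k by (auto simp: I_def)
    have finI: "finite I" using I(1) finite_subset by blast
    obtain x a where x: "(\<Sum>i\<in>I. qnorm2 (x i)) = 1" "\<And>i. i \<notin> I \<Longrightarrow> x i = 0"
      and ev: "\<And>i. i \<in> I \<Longrightarrow> (\<Sum>j\<in>I. T $$ (i, j) * x j) = a *\<^sub>R x i"
      using hermitian_eigenvector[OF finI, of "\<lambda>i j. T $$ (i, j)"] I sym by blast
    obtain G where G: "quat.unitary n G" and Gk: "\<And>i. i < n \<Longrightarrow> G $$ (i, k) = x i"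
      and Goff: "\<And>i j. i < n \<Longrightarrow> j < n \<Longrightarrow> i \<notin> I \<or> j \<notin> I \<Longrightarrow> G $$ (i, j) = (if i = j then 1 else 0)"
      using unitary_with_column[OF I x] by metis
    note Gc = quat.unitary_carrier[OF G]
    define T' where "T' = quat.adj G * T * G"
    have T'c: "T' \<in> carrier_mat n n" using Gc T by (auto simp: T'_def)
    have T'h: "quat.adj T' = T'" unfolding T'_def using quat.adj_conj[OF Gc T Gc] herm by simp
    have T'sym: "T' $$ (j, i) = quat_cnj (T' $$ (i, j))" if "i < n" "j < n" for i j
      using quat.adj_index[of j T' i] that T'c by (simp add: T'h)
    have T'ij: "T' $$ (i, j) = (\<Sum>l<n. quat_cnj (G $$ (l, i)) * (\<Sum>m<n. T $$ (l, m) * G $$ (m, j)))"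
      if "i < n" "j < n" for i j
      unfolding T'_def using that by (simp add: quat.conj_index[OF Gc T Gc] sum_distrib_left mult.assoc)
    have Gd: "d i = d j" if "i < n" "j < n" "G $$ (i, j) \<noteq> 0" for i j
      using that Goff[OF that(1,2)] by (cases "i \<in> I \<and> j \<in> I") (auto simp: I_def split: if_splits)
    have T'd: "d i = d j" if ij: "i < n" "j < n" and nz: "T' $$ (i, j) \<noteq> 0" for i j
    proof -
      obtain l where l: "l < n" "quat_cnj (G $$ (l, i)) * (\<Sum>m<n. T $$ (l, m) * G $$ (m, j)) \<noteq> 0"
        using nz unfolding T'ij[OF ij] by (metis (no_types, lifting) lessThan_iff sum.neutral)
      obtain m where m: "m < n" "T $$ (l, m) * G $$ (m, j) \<noteq> 0"
        using l(2) by (metis (no_types, lifting) lessThan_iff mult_zero_right sum.neutral)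
      have "G $$ (l, i) \<noteq> 0" "T $$ (l, m) \<noteq> 0" "G $$ (m, j) \<noteq> 0" using l m by auto
      thus ?thesis using Gd[of l i] Gd[of m j] blk l m ij by metis
    qed
    have dnT': "dn T' i" if i: "i < n" "dn T i" for i
      unfolding dn_def
    proof (intro allI impI)
      fix j assume j: "j < n" "j \<noteq> i"
      have iI: "i \<notin> I" using i by (simp add: I_def)
      have "T' $$ (i, j) = (\<Sum>l<n. if l = i then \<Sum>m<n. T $$ (i, m) * G $$ (m, j) else 0)"
        unfolding T'ij[OF i(1) j(1)] using iI i by (intro sum.cong) (auto simp: Goff)
      also have "\<dots> = (\<Sum>m<n. T $$ (i, m) * G $$ (m, j))" using i by simp
      also have "\<dots> = 0"
      proof (rule sum.neutral, safe)
        fix m assume "m < n"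
        thus "T $$ (i, m) * G $$ (m, j) = 0"
          using i j iI by (cases "m = i") (auto simp: dn_def Goff)
      qed
      finally show "T' $$ (i, j) = 0" .
    qed
    have Tx: "(\<Sum>m<n. T $$ (l, m) * G $$ (m, k)) = a *\<^sub>R x l" if l: "l < n" for l
    proof -
      have eq: "(\<Sum>m<n. T $$ (l, m) * G $$ (m, k)) = (\<Sum>m\<in>I. T $$ (l, m) * x m)"
        using I(1) by (intro sum.mono_neutral_cong_right) (auto simp: Gk x)
      show ?thesis
      proof (cases "l \<in> I")
        case True
        thus ?thesis using eq ev by simp
      next
        case False
        have "T $$ (l, m) = 0" if m: "m \<in> I" for m
        proof (cases "d l = d k")
          case True
          hence "dn T l" using False l by (simp add: I_def)
          moreover have "m \<noteq> l" "m < n" using False m by (auto simp: I_def)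
          ultimately show ?thesis by (simp add: dn_def)
        next
          case False
          thus ?thesis using blk m l by (fastforce simp: I_def)
        qed
        thus ?thesis using eq False x by simp
      qed
    qed
    have T'k: "T' $$ (i, k) = 0" if "i < n" "i \<noteq> k" for i
    proof -
      have "T' $$ (i, k) = (\<Sum>l<n. a *\<^sub>R (quat_cnj (G $$ (l, i)) * G $$ (l, k)))"
        unfolding T'ij[OF that(1) k(1)]
      proof (intro sum.cong refl)
        fix l assume "l \<in> {..<n}"
        hence l: "l < n" by simp
        show "quat_cnj (G $$ (l, i)) * (\<Sum>m<n. T $$ (l, m) * G $$ (m, k))
          = a *\<^sub>R (quat_cnj (G $$ (l, i)) * G $$ (l, k))"
          by (simp only: Tx[OF l] Gk[OF l] mult_scaleR_right)
      qed
      thus ?thesis using quat.unitary_sum[OF G that(1) k(1)] that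
        by (simp flip: scaleR_sum_right)
    qed
    have dnk: "dn T' k"
      unfolding dn_def
    proof (intro allI impI)
      fix j assume j: "j < n" "j \<noteq> k"
      have "T' $$ (k, j) = quat_cnj (T' $$ (j, k))" by (rule T'sym[OF j(1) k(1)])
      thus "T' $$ (k, j) = 0" by (simp add: T'k[OF j])
    qed
    have "{i. i < n \<and> \<not> dn T' i} \<subset> {i. i < n \<and> \<not> dn T i}"
      using dnT' dnk k by blast
    hence "card {i. i < n \<and> \<not> dn T' i} < card {i. i < n \<and> \<not> dn T i}"
      by (intro psubset_card_mono) auto
    note IH = less.hyps[OF this[unfolded dn_def] T'c T'h]
    have "\<forall>i<n. \<forall>j<n. T' $$ (i, j) \<noteq> 0 \<longrightarrow> d i = d j" using T'd by blast
    from IH[OF this] obtain W where W: "quat.unitary n W"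
      and Wd': "\<forall>i<n. \<forall>j<n. W $$ (i, j) \<noteq> 0 \<longrightarrow> d i = d j"
      and Woff': "\<forall>i<n. (\<forall>j<n. j \<noteq> i \<longrightarrow> T' $$ (i, j) = 0) \<longrightarrow>
        (\<forall>j<n. W $$ (i, j) = (if i = j then 1 else 0) \<and> W $$ (j, i) = (if i = j then 1 else 0))"
      and Wdiag': "\<forall>i<n. \<forall>j<n. i \<noteq> j \<longrightarrow> (quat.adj W * T' * W) $$ (i, j) = 0"
      by (elim exE conjE) (rule that)
    have Wd: "d i = d j" if "i < n" "j < n" "W $$ (i, j) \<noteq> 0" for i j
      using Wd' that by blast
    have Woff: "W $$ (i, j) = (if i = j then 1 else 0) \<and> W $$ (j, i) = (if i = j then 1 else 0)"
      if "i < n" "dn T' i" "j < n" for i j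
      using Woff' that unfolding dn_def by blast
    have Wdiag: "(quat.adj W * T' * W) $$ (i, j) = 0" if "i < n" "j < n" "i \<noteq> j" for i j
      using Wdiag' that by blast
    note Wc = quat.unitary_carrier[OF W]
    have GW: "(G * W) $$ (i, j) = (\<Sum>l<n. G $$ (i, l) * W $$ (l, j))" if "i < n" "j < n" for i j
      using index_mult_mat_sum[OF Gc Wc that] .
    show ?thesis
    proof (intro exI[of _ "G * W"] conjI allI impI)
      show "quat.unitary n (G * W)" by (rule quat.unitary_mult[OF G W])
    next
      fix i j assume ij: "i < n" "j < n" "(G * W) $$ (i, j) \<noteq> 0"
      then obtain l where l: "l < n" "G $$ (i, l) * W $$ (l, j) \<noteq> 0"
        unfolding GW[OF ij(1,2)] by (metis (no_types, lifting) lessThan_iff sum.neutral)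
      hence "G $$ (i, l) \<noteq> 0" "W $$ (l, j) \<noteq> 0" by auto
      thus "d i = d j" using Gd[of i l] Wd[of l j] l ij by simp
    next
      fix i j assume i: "i < n" "\<forall>j<n. j \<noteq> i \<longrightarrow> T $$ (i, j) = 0" and j: "j < n"
      have dni: "dn T i" "dn T' i" "i \<notin> I" using i dnT' by (auto simp: dn_def I_def)
      have "(G * W) $$ (i, j) = (\<Sum>l<n. if l = i then W $$ (i, j) else 0)"
        unfolding GW[OF i(1) j] using i dni by (intro sum.cong) (auto simp: Goff)
      thus "(G * W) $$ (i, j) = (if i = j then 1 else 0)" using i Woff[OF i(1) dni(2) j] by simp
      have "(G * W) $$ (j, i) = (\<Sum>l<n. if l = i then G $$ (j, i) else 0)"
        unfolding GW[OF j i(1)] using i dni j by (intro sum.cong) (auto simp: Woff)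
      thus "(G * W) $$ (j, i) = (if i = j then 1 else 0)" using i dni j by (auto simp: Goff)
    next
      fix i j assume "i < n" "j < n" "i \<noteq> j"
      thus "(quat.adj (G * W) * T * (G * W)) $$ (i, j) = 0"
        using Wdiag unfolding quat.conj_mult_mult[OF Gc Wc T Gc Wc] T'_def by simp
    qed
  qed
qed

section \<open>Quaternion singular value decomposition\<close>

lemma quat_unitary_cancel:
  assumes U: "quat.unitary n U" and X: "X \<in> carrier_mat n k"
  shows "U * (quat.adj U * X) = X"
proof -
  note c = quat.unitary_carrier[OF U]
  have "U * (quat.adj U * X) = U * quat.adj U * X"
    using c X by (subst assoc_mult_mat[of _ n n _ n _ k]) auto
  thus ?thesis using quat_unitary_adj[OF U] X by (simp add: quat.unitary_def)
qed

lemma quat_adj_mult_conj: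
  assumes G: "quat.unitary m G" and A: "A \<in> carrier_mat m n" and P: "P \<in> carrier_mat n n"
  shows "quat.adj (quat.adj G * A * P) * (quat.adj G * A * P) = quat.adj P * (quat.adj A * A) * P"
proof -
  note c = quat.unitary_carrier[OF G]
  have cs: "quat.adj P * quat.adj A \<in> carrier_mat n m" "quat.adj G * A * P \<in> carrier_mat m n"
    "quat.adj A \<in> carrier_mat n m" "quat.adj P \<in> carrier_mat n n"
    "A * P \<in> carrier_mat m n" "quat.adj A * A \<in> carrier_mat n n"
    using c A P by auto
  have "quat.adj (quat.adj G * A * P) * (quat.adj G * A * P)
      = quat.adj P * quat.adj A * (G * (quat.adj G * A * P))"
    unfolding quat.adj_conj[OF c A P] by (rule assoc_mult_mat[OF cs(1) c cs(2)])
  also have "G * (quat.adj G * A * P) = A * P"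
    unfolding assoc_mult_mat[OF quat.adj_carrier[OF c] A P]
    by (rule quat_unitary_cancel[OF G cs(5)])
  also have "quat.adj P * quat.adj A * (A * P) = quat.adj P * (quat.adj A * (A * P))"
    by (rule assoc_mult_mat[OF cs(4,3,5)])
  also have "quat.adj A * (A * P) = quat.adj A * A * P"
    by (rule assoc_mult_mat[OF cs(3) A P, symmetric])
  also have "quat.adj P * (quat.adj A * A * P) = quat.adj P * (quat.adj A * A) * P"
    by (rule assoc_mult_mat[OF cs(4,6) P, symmetric])
  finally show ?thesis .
qed

definition fixes_below :: "nat \<Rightarrow> nat \<Rightarrow> quat mat \<Rightarrow> bool" where
  "fixes_below k n U \<longleftrightarrow>
    (\<forall>i<n. \<forall>j<n. i < k \<or> j < k \<longrightarrow> U $$ (i, j) = (if i = j then 1 else 0))"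

lemma fixes_below_mult:
  assumes A: "A \<in> carrier_mat n n" and B: "B \<in> carrier_mat n n"
    and f: "fixes_below k n A" "fixes_below k n B"
  shows "fixes_below k n (A * B)"
  unfolding fixes_below_def
proof (intro allI impI)
  fix i j assume ij: "i < n" "j < n" "i < k \<or> j < k"
  have "(A * B) $$ (i, j) = (\<Sum>l<n. A $$ (i, l) * B $$ (l, j))"
    by (rule index_mult_mat_sum[OF A B ij(1,2)])
  also have "\<dots> = (\<Sum>l<n. if l = (if i < k then i else j) then if i = j then 1 else 0 else 0)"
    using ij f by (intro sum.cong) (auto simp: fixes_below_def)
  also have "\<dots> = (if i = j then 1 else 0)" using ij by simp
  finally show "(A * B) $$ (i, j) = (if i = j then 1 else 0)" .
qed

lemma fixes_below_mono: "fixes_below k n U \<Longrightarrow> j \<le> k \<Longrightarrow> fixes_below j n U"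
  by (auto simp: fixes_below_def)

lemma quat_diagonalize_orthogonal_columns:
  assumes "A \<in> carrier_mat m n" "k \<le> m" "k \<le> n"
    and "\<forall>i<n. \<forall>j<n. i \<noteq> j \<longrightarrow> (quat.adj A * A) $$ (i, j) = 0"
    and "\<forall>i<m. \<forall>j<n. i \<noteq> j \<and> (i < k \<or> j < k) \<longrightarrow> A $$ (i, j) = 0"
  shows "\<exists>V U s. quat.unitary m V \<and> quat.unitary n U \<and> k \<le> s \<and> s \<le> min m n \<and>
    fixes_below k m V \<and> fixes_below k n U \<and>
    (\<forall>i<m. \<forall>j<n. i \<noteq> j \<longrightarrow> (quat.adj V * A * U) $$ (i, j) = 0) \<and>
    (\<forall>j. k \<le> j \<and> j < s \<longrightarrow> (\<exists>c>0. (quat.adj V * A * U) $$ (j, j) = of_real c)) \<and>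
    (\<forall>j. s \<le> j \<and> j < min m n \<longrightarrow> (quat.adj V * A * U) $$ (j, j) = 0)"
  using assms
proof (induction "n - k" arbitrary: k A)
  case (0 k A)
  hence [simp]: "k = n" by simp
  show ?case
    by (rule exI[of _ "1\<^sub>m m"], rule exI[of _ "1\<^sub>m n"], rule exI[of _ k])
      (use 0 in \<open>auto simp: fixes_below_def\<close>)
next
  case (Suc r k A)
  note A = Suc.prems(1) and orth = Suc.prems(4)
  have dg: "A $$ (i, j) = 0" if "i < m" "j < n" "i \<noteq> j" "i < k \<or> j < k" for i j
    using Suc.prems(5) that by blast
  show ?case
  proof (cases "\<forall>i<m. \<forall>j<n. k \<le> i \<and> k \<le> j \<longrightarrow> A $$ (i, j) = 0")
    case True
    hence z: "A $$ (i, j) = 0" if "i < m" "j < n" "i \<noteq> j \<or> k \<le> i" for i j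
      using True dg[of i j] that by (cases "k \<le> i \<and> k \<le> j") auto
    show ?thesis
      by (rule exI[of _ "1\<^sub>m m"], rule exI[of _ "1\<^sub>m n"], rule exI[of _ k])
        (use Suc.prems(2,3) A z in \<open>auto simp: fixes_below_def\<close>)
  next
    case False
    then obtain i0 l where l: "i0 < m" "l < n" "k \<le> i0" "k \<le> l" "A $$ (i0, l) \<noteq> 0" by blast
    hence k: "k < m" "k < n" by auto
    define p where "p = transpose k l"
    have p: "p permutes {..<n}" using l k by (auto simp: p_def intro: permutes_swap_id)
    have pk: "p k = l" and p_less: "\<And>j. j < k \<Longrightarrow> p j = j"
      and p_ge: "\<And>j. k \<le> j \<Longrightarrow> k \<le> p j" and p_lt: "\<And>j. j < n \<Longrightarrow> p j < n"
      using l k by (auto simp: p_def transpose_def)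
    define P :: "quat mat" where "P = mat n n (\<lambda>(i, j). if i = p j then 1 else 0)"
    have P: "quat.unitary n P" unfolding P_def by (rule quat.perm_mat_unitary[OF p])
    note Pc = quat.unitary_carrier[OF P]
    define S where "S = (\<Sum>i\<in>{k..<m}. qnorm2 (A $$ (i, l)))"
    have S: "S > 0" unfolding S_def using l
      by (intro sum_pos2[of _ i0]) (auto simp: less_le)
    define x where "x i = (if i \<in> {k..<m} then (1 / sqrt S) *\<^sub>R A $$ (i, l) else 0)" for i
    have x1: "(\<Sum>i\<in>{k..<m}. qnorm2 (x i)) = 1"
      using S by (simp add: x_def qnorm2_scaleR power_divide S_def[symmetric] flip: sum_divide_distrib)
    have Al: "A $$ (i, l) = sqrt S *\<^sub>R x i" if "i < m" for i
      using that S dg[of i l] l by (auto simp: x_def)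
    have x0: "x i = 0" if "i \<notin> {k..<m}" for i using that by (simp only: x_def if_False)
    have I: "{k..<m} \<subseteq> {..<m}" "k \<in> {k..<m}" using k by auto
    obtain G where G: "quat.unitary m G" and Gk: "\<And>i. i < m \<Longrightarrow> G $$ (i, k) = x i"
      and Goff: "\<And>i j. i < m \<Longrightarrow> j < m \<Longrightarrow> i \<notin> {k..<m} \<or> j \<notin> {k..<m} \<Longrightarrow>
        G $$ (i, j) = (if i = j then 1 else 0)"
      using unitary_with_column[OF I x1 x0] by metis
    note Gc = quat.unitary_carrier[OF G]
    have fG: "fixes_below k m G" using Goff by (auto simp: fixes_below_def)
    have fP: "fixes_below k n P"
      unfolding fixes_below_def
    proof (intro allI impI)
      fix i j assume ij: "i < n" "j < n" "i < k \<or> j < k"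
      have "i = p j \<longleftrightarrow> i = j"
        using ij(3) p_less[of j] p_ge[of j] by (cases "j < k") auto
      thus "P $$ (i, j) = (if i = j then 1 else 0)" using ij by (simp add: P_def)
    qed
    define A' where "A' = quat.adj G * A * P"
    have A'c: "A' \<in> carrier_mat m n" using Gc A Pc by (auto simp: A'_def)
    have A'_ij: "A' $$ (i, j) = (\<Sum>a<m. quat_cnj (G $$ (a, i)) * A $$ (a, p j))"
      if ij: "i < m" "j < n" for i j
    proof -
      have "A' $$ (i, j) = (\<Sum>a<m. \<Sum>b<n. if b = p j then quat_cnj (G $$ (a, i)) * A $$ (a, p j) else 0)"
        unfolding A'_def quat.conj_index[OF Gc A Pc ij] using ij by (intro sum.cong) (auto simp: P_def)
      thus ?thesis using p_lt[OF ij(2)] by simp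
    qed
    have orth': "(quat.adj A' * A') $$ (i, j) = 0" if ij: "i < n" "j < n" "i \<noteq> j" for i j
    proof -
      have "p i \<noteq> p j" using ij permutes_inj[OF p] by (auto dest: injD)
      moreover have "quat.adj A * A \<in> carrier_mat n n" using A by auto
      ultimately show ?thesis
        unfolding A'_def quat_adj_mult_conj[OF G A Pc]
        using quat.conj_perm_mat[OF p p _ ij(1,2)] orth p_lt ij by (simp add: P_def)
    qed
    have A'k: "A' $$ (i, k) = (if i = k then of_real (sqrt S) else 0)" if "i < m" for i
    proof -
      have "A' $$ (i, k) = (\<Sum>a<m. sqrt S *\<^sub>R (quat_cnj (G $$ (a, i)) * G $$ (a, k)))"
        unfolding A'_ij[OF that k(2)] pk by (intro sum.cong) (auto simp: Al Gk)
      thus ?thesis using quat.unitary_sum[OF G that k(1)]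
        by (simp flip: scaleR_sum_right) (simp add: of_real_def)
    qed
    have dg': "A' $$ (i, j) = 0" if ij: "i < m" "j < n" "i \<noteq> j" "i < Suc k \<or> j < Suc k" for i j
    proof -
      consider "i < k" | "j < k" | "j = k" | "i = k" "j \<noteq> k" using ij by linarith
      thus ?thesis
      proof cases
        case 1
        have "p j \<noteq> i" using 1 ij p_less p_ge by (metis leD not_le)
        have "A' $$ (i, j) = (\<Sum>a<m. if a = i then A $$ (i, p j) else 0)"
          unfolding A'_ij[OF ij(1,2)] using 1 ij by (intro sum.cong) (auto simp: Goff)
        thus ?thesis using ij 1 \<open>p j \<noteq> i\<close> dg[of i "p j"] p_lt by auto
      next
        case 2
        have "A' $$ (i, j) = (\<Sum>a<m. 0)"
          unfolding A'_ij[OF ij(1,2)]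
        proof (intro sum.cong refl)
          fix a assume a: "a \<in> {..<m}"
          show "quat_cnj (G $$ (a, i)) * A $$ (a, p j) = 0"
            using 2 ij a dg[of a j] Goff[of j i] by (cases "a = j") (auto simp: p_less)
        qed
        thus ?thesis by simp
      next
        case 3
        thus ?thesis using A'k ij by simp
      next
        case 4
        have "0 = (quat.adj A' * A') $$ (k, j)" using orth' ij k 4 by simp
        also have "\<dots> = (\<Sum>a<m. quat.adj A' $$ (k, a) * A' $$ (a, j))"
          using A'c ij k by (intro index_mult_mat_sum[of _ n m _ n]) auto
        also have "\<dots> = (\<Sum>a<m. if a = k then of_real (sqrt S) * A' $$ (k, j) else 0)"
          using A'c k by (intro sum.cong) (auto simp: A'k)
        also have "\<dots> = sqrt S *\<^sub>R A' $$ (k, j)" using k by (simp add: of_real_mult_quat)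
        finally show ?thesis using S 4 by simp
      qed
    qed
    have "r = n - Suc k" using Suc.hyps(2) by simp
    note IH = Suc.hyps(1)[OF this A'c]
    have "Suc k \<le> m" "Suc k \<le> n" using k by auto
    moreover have "\<forall>i<n. \<forall>j<n. i \<noteq> j \<longrightarrow> (quat.adj A' * A') $$ (i, j) = 0"
      using orth' by blast
    moreover have "\<forall>i<m. \<forall>j<n. i \<noteq> j \<and> (i < Suc k \<or> j < Suc k) \<longrightarrow> A' $$ (i, j) = 0"
      using dg' by blast
    note IH[OF calculation this]
    then obtain V U s where
      V: "quat.unitary m V" and U: "quat.unitary n U" and s: "Suc k \<le> s" "s \<le> min m n"
      and fV: "fixes_below (Suc k) m V" and fU: "fixes_below (Suc k) n U"
      and diag: "\<forall>i<m. \<forall>j<n. i \<noteq> j \<longrightarrow> (quat.adj V * A' * U) $$ (i, j) = 0"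
      and pos: "\<forall>j. Suc k \<le> j \<and> j < s \<longrightarrow> (\<exists>c>0. (quat.adj V * A' * U) $$ (j, j) = of_real c)"
      and zero: "\<forall>j. s \<le> j \<and> j < min m n \<longrightarrow> (quat.adj V * A' * U) $$ (j, j) = 0"
      by (elim exE conjE) (rule that)
    note Vc = quat.unitary_carrier[OF V] and Uc = quat.unitary_carrier[OF U]
    have eq: "quat.adj (G * V) * A * (P * U) = quat.adj V * A' * U"
      unfolding A'_def by (rule quat.conj_mult_mult[OF Gc Vc A Pc Uc])
    have kk: "(quat.adj V * A' * U) $$ (k, k) = of_real (sqrt S)"
    proof -
      have "(quat.adj V * A' * U) $$ (k, k)
        = (\<Sum>a<m. \<Sum>b<n. if b = k then if a = k then of_real (sqrt S) else 0 else 0)"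
        unfolding quat.conj_index[OF Vc A'c Uc k] using k fV fU
        by (intro sum.cong refl) (auto simp: fixes_below_def A'k)
      thus ?thesis using k by simp
    qed
    show ?thesis
    proof (rule exI[of _ "G * V"], rule exI[of _ "P * U"], rule exI[of _ s], unfold eq, intro conjI allI impI)
      show "quat.unitary m (G * V)" "quat.unitary n (P * U)"
        using G V P U by (auto intro: quat.unitary_mult)
      show "fixes_below k m (G * V)"
        using fG fixes_below_mono[OF fV] Gc Vc by (intro fixes_below_mult) auto
      show "fixes_below k n (P * U)"
        using fP fixes_below_mono[OF fU] Pc Uc by (intro fixes_below_mult) auto
      show "\<exists>c>0. (quat.adj V * A' * U) $$ (j, j) = of_real c" if "k \<le> j \<and> j < s" for j
        using that pos kk S by (cases "j = k") (auto intro: exI[of _ "sqrt S"])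
    qed (use s diag zero in auto)
  qed
qed

lemma quat_svd_from:
  assumes A: "A \<in> carrier_mat m n" and k: "k \<le> m" "k \<le> n"
    and zero: "\<And>i j. i < m \<Longrightarrow> j < n \<Longrightarrow> i < k \<or> j < k \<Longrightarrow> A $$ (i, j) = 0"
  obtains V U s where "quat.unitary m V" "quat.unitary n U" "k \<le> s" "s \<le> min m n"
    "fixes_below k m V" "fixes_below k n U"
    "\<And>i j. i < m \<Longrightarrow> j < n \<Longrightarrow> i \<noteq> j \<Longrightarrow> (quat.adj V * A * U) $$ (i, j) = 0"
    "\<And>j. k \<le> j \<Longrightarrow> j < s \<Longrightarrow> \<exists>c>0. (quat.adj V * A * U) $$ (j, j) = of_real c"
    "\<And>j. s \<le> j \<Longrightarrow> j < min m n \<Longrightarrow> (quat.adj V * A * U) $$ (j, j) = 0"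
proof -
  have c: "quat.adj A * A \<in> carrier_mat n n" using A by auto
  have h: "quat.adj (quat.adj A * A) = quat.adj A * A"
    using quat.adj_mult[OF quat.adj_carrier[OF A] A] by simp
  have z: "(quat.adj A * A) $$ (i, j) = 0" if "i < n" "j < n" "i < k" for i j
  proof -
    have "(quat.adj A * A) $$ (i, j) = (\<Sum>a<m. quat.adj A $$ (i, a) * A $$ (a, j))"
      using A that by (intro index_mult_mat_sum[of _ n m _ n]) auto
    also have "\<dots> = 0" using A that zero by (intro sum.neutral) auto
    finally show ?thesis .
  qed
  obtain W where W: "quat.unitary n W" and Woff: "\<And>i j. i < n \<Longrightarrow> j < n \<Longrightarrow>
      (\<forall>j<n. j \<noteq> i \<longrightarrow> (quat.adj A * A) $$ (i, j) = 0) \<Longrightarrow>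
      W $$ (i, j) = (if i = j then 1 else 0) \<and> W $$ (j, i) = (if i = j then 1 else 0)"
    and Wdiag: "\<And>i j. i < n \<Longrightarrow> j < n \<Longrightarrow> i \<noteq> j \<Longrightarrow> (quat.adj W * (quat.adj A * A) * W) $$ (i, j) = 0"
    using quat_spectral_blocks[OF c h, of "\<lambda>_. ()"] by auto
  note Wc = quat.unitary_carrier[OF W]
  have fW: "fixes_below k n W"
    unfolding fixes_below_def
  proof (intro allI impI)
    fix i j assume ij: "i < n" "j < n" "i < k \<or> j < k"
    thus "W $$ (i, j) = (if i = j then 1 else 0)"
      using z Woff[of i j] Woff[of j i] by (cases "i < k") auto
  qed
  define A' where "A' = quat.adj (1\<^sub>m m) * A * W"
  have A': "A' \<in> carrier_mat m n" using A Wc by (auto simp: A'_def)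
  have orth: "(quat.adj A' * A') $$ (i, j) = 0" if "i < n" "j < n" "i \<noteq> j" for i j
    unfolding A'_def quat_adj_mult_conj[OF quat.unitary_one A Wc] using Wdiag that .
  have zero': "A' $$ (i, j) = 0" if ij: "i < m" "j < n" "i < k \<or> j < k" for i j
  proof -
    have "A' $$ (i, j) = (\<Sum>a<n. A $$ (i, a) * W $$ (a, j))"
      unfolding A'_def using A Wc ij by (simp add: index_mult_mat_sum[OF A Wc] del: index_mult_mat(1))
    also have "\<dots> = 0"
    proof (rule sum.neutral, safe)
      fix a assume "a < n"
      thus "A $$ (i, a) * W $$ (a, j) = 0"
        using ij fW zero[of i a] by (cases "i < k \<or> a < k") (auto simp: fixes_below_def)
    qed
    finally show ?thesis .
  qed
  have "\<forall>i<n. \<forall>j<n. i \<noteq> j \<longrightarrow> (quat.adj A' * A') $$ (i, j) = 0"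
    "\<forall>i<m. \<forall>j<n. i \<noteq> j \<and> (i < k \<or> j < k) \<longrightarrow> A' $$ (i, j) = 0"
    using orth zero' by blast+
  from quat_diagonalize_orthogonal_columns[OF A' k this]
  obtain V U s where V: "quat.unitary m V" and U: "quat.unitary n U" and s: "k \<le> s" "s \<le> min m n"
    and f: "fixes_below k m V" "fixes_below k n U"
    and r: "\<forall>i<m. \<forall>j<n. i \<noteq> j \<longrightarrow> (quat.adj V * A' * U) $$ (i, j) = 0"
      "\<forall>j. k \<le> j \<and> j < s \<longrightarrow> (\<exists>c>0. (quat.adj V * A' * U) $$ (j, j) = of_real c)"
      "\<forall>j. s \<le> j \<and> j < min m n \<longrightarrow> (quat.adj V * A' * U) $$ (j, j) = 0" by blast
  note Vc = quat.unitary_carrier[OF V] and Uc = quat.unitary_carrier[OF U]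
  have "quat.adj (1\<^sub>m m * V) * A * (W * U) = quat.adj V * A' * U"
    unfolding A'_def by (rule quat.conj_mult_mult[OF _ Vc A Wc Uc]) simp
  hence eq: "quat.adj V * A * (W * U) = quat.adj V * A' * U" using Vc by simp
  show thesis
  proof (rule that[of V "W * U" s], unfold eq)
    show "quat.unitary n (W * U)" by (rule quat.unitary_mult[OF W U])
    show "fixes_below k n (W * U)" by (rule fixes_below_mult[OF Wc Uc fW f(2)])
  qed (use V s f r in blast)+
qed

lemma quat_intertwine_conj:
  assumes V: "quat.unitary m V" and S: "S \<in> carrier_mat m n" and U: "U \<in> carrier_mat n n"
    and eq: "S * U = V * S"
  shows "quat.adj V * S * U = S"
proof -
  note c = quat.unitary_carrier[OF V]
  have "quat.adj V * S * U = quat.adj V * (V * S)"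
    unfolding eq[symmetric] by (rule assoc_mult_mat[OF quat.adj_carrier[OF c] S U])
  also have "\<dots> = quat.adj V * V * S"
    by (rule assoc_mult_mat[OF quat.adj_carrier[OF c] c S, symmetric])
  also have "\<dots> = S" using V S by (simp add: quat.unitary_def)
  finally show ?thesis .
qed

definition diag_rect :: "nat \<Rightarrow> nat \<Rightarrow> (nat \<Rightarrow> 'a :: zero) \<Rightarrow> 'a mat" where
  "diag_rect m n f = mat m n (\<lambda>(i, j). if i = j then f i else 0)"

lemma diag_rect_carrier [simp]: "diag_rect m n f \<in> carrier_mat m n"
  and diag_rect_dim [simp]: "dim_row (diag_rect m n f) = m" "dim_col (diag_rect m n f) = n"
  and diag_rect_index [simp]:
    "i < m \<Longrightarrow> j < n \<Longrightarrow> diag_rect m n f $$ (i, j) = (if i = j then f i else 0)"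
  by (auto simp: diag_rect_def)

lemma diag_rect_mult_index:
  fixes X :: "'a :: semiring_0 mat"
  assumes "X \<in> carrier_mat n n" "i < m" "j < n"
  shows "(diag_rect m n f * X) $$ (i, j) = (if i < n then f i * X $$ (i, j) else 0)"
proof -
  have "(diag_rect m n f * X) $$ (i, j) = (\<Sum>l<n. diag_rect m n f $$ (i, l) * X $$ (l, j))"
    using assms by (intro index_mult_mat_sum[of _ m n _ n]) auto
  also have "\<dots> = (\<Sum>l<n. if l = i then f i * X $$ (i, j) else 0)"
    using assms by (intro sum.cong) auto
  finally show ?thesis by simp
qed

lemma mult_diag_rect_index:
  fixes X :: "'a :: semiring_0 mat"
  assumes "X \<in> carrier_mat m m" "i < m" "j < n"
  shows "(X * diag_rect m n f) $$ (i, j) = (if j < m then X $$ (i, j) * f j else 0)"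
proof -
  have "(X * diag_rect m n f) $$ (i, j) = (\<Sum>l<m. X $$ (i, l) * diag_rect m n f $$ (l, j))"
    using assms by (intro index_mult_mat_sum[of _ m m _ n]) auto
  also have "\<dots> = (\<Sum>l<m. if l = j then X $$ (i, j) * f j else 0)"
    using assms by (intro sum.cong) auto
  finally show ?thesis by simp
qed

text \<open>After a singular value decomposition of \<open>A\<close>, the remaining freedom (unitaries commuting with
  the singular values) is used to bring \<open>E\<close> into normal form: on the block of a positive singular
  value only its Hermitian part is diagonalised, as the rest is removed later at order \<open>\<epsilon>\<close>.\<close>

lemma quat_svd_with_perturbation:
  assumes A: "A \<in> carrier_mat m n" and E: "E \<in> carrier_mat m n"
  obtains V U and \<sigma> :: "nat \<Rightarrow> real" where "quat.unitary m V" "quat.unitary n U"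
    "\<And>i. 0 \<le> \<sigma> i" "\<And>i. min m n \<le> i \<Longrightarrow> \<sigma> i = 0"
    "quat.adj V * A * U = diag_rect m n (\<lambda>i. of_real (\<sigma> i))"
    "\<And>i j. i < min m n \<Longrightarrow> j < min m n \<Longrightarrow> i \<noteq> j \<Longrightarrow> \<sigma> i = \<sigma> j \<Longrightarrow> \<sigma> i \<noteq> 0 \<Longrightarrow>
      (quat.adj V * E * U) $$ (i, j) + quat_cnj ((quat.adj V * E * U) $$ (j, i)) = 0"
    "\<And>i j. i < m \<Longrightarrow> j < n \<Longrightarrow> i \<noteq> j \<Longrightarrow> \<sigma> i = 0 \<Longrightarrow> \<sigma> j = 0 \<Longrightarrow> (quat.adj V * E * U) $$ (i, j) = 0"
    "\<And>i. i < min m n \<Longrightarrow> \<sigma> i = 0 \<Longrightarrow> \<exists>c\<ge>0. (quat.adj V * E * U) $$ (i, i) = of_real c"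
proof -
  obtain V1 U1 s where V1: "quat.unitary m V1" and U1: "quat.unitary n U1" and s: "s \<le> min m n"
    and off: "\<And>i j. i < m \<Longrightarrow> j < n \<Longrightarrow> i \<noteq> j \<Longrightarrow> (quat.adj V1 * A * U1) $$ (i, j) = 0"
    and pos: "\<And>j. j < s \<Longrightarrow> \<exists>c>0. (quat.adj V1 * A * U1) $$ (j, j) = of_real c"
    and zero: "\<And>j. s \<le> j \<Longrightarrow> j < min m n \<Longrightarrow> (quat.adj V1 * A * U1) $$ (j, j) = 0"
    using quat_svd_from[OF A, of 0] by (metis le0 less_nat_zero_code)
  note V1c = quat.unitary_carrier[OF V1] and U1c = quat.unitary_carrier[OF U1]
  define \<sigma> where "\<sigma> i = (if i < s then q_re ((quat.adj V1 * A * U1) $$ (i, i)) else 0)" for i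
  have \<sigma>_pos: "\<sigma> i > 0" if "i < s" for i using pos[OF that] that by (auto simp: \<sigma>_def)
  have \<sigma>_0: "\<sigma> i = 0" if "s \<le> i" for i using that by (simp add: \<sigma>_def)
  define S where "S = diag_rect m n (\<lambda>i. of_real (\<sigma> i) :: quat)"
  have Sc: "S \<in> carrier_mat m n" by (simp add: S_def)
  have S: "quat.adj V1 * A * U1 = S"
  proof (rule eq_matI)
    fix i j assume "i < dim_row S" "j < dim_col S"
    hence ij: "i < m" "j < n" by (simp_all add: S_def)
    show "(quat.adj V1 * A * U1) $$ (i, j) = S $$ (i, j)"
    proof (cases "i = j")
      case True
      show ?thesis
      proof (cases "i < s")
        case True
        thus ?thesis using pos[OF True] ij \<open>i = j\<close> by (auto simp: S_def \<sigma>_def)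
      next
        case False
        thus ?thesis using zero[of i] ij \<open>i = j\<close> by (simp add: S_def \<sigma>_def)
      qed
    next
      case False
      thus ?thesis using off[OF ij] ij by (simp add: S_def)
    qed
  qed (use V1c U1c in \<open>simp_all add: S_def\<close>)
  define C1 where "C1 = quat.adj V1 * E * U1"
  have C1c: "C1 \<in> carrier_mat m n" unfolding C1_def using V1c U1c E by auto
  define K where "K = mat n n (\<lambda>(i, j). if i < s \<and> j < s \<and> \<sigma> i = \<sigma> j
    then C1 $$ (i, j) + quat_cnj (C1 $$ (j, i)) else 0)"
  have Kc: "K \<in> carrier_mat n n" by (simp add: K_def)
  have Kh: "quat.adj K = K"
    by (rule eq_matI) (auto simp: K_def quat_cnj_add add.commute)
  have Kb: "\<forall>i<n. \<forall>j<n. K $$ (i, j) \<noteq> 0 \<longrightarrow> \<sigma> i = \<sigma> j" by (simp add: K_def)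
  from quat_spectral_blocks[OF Kc Kh Kb] obtain W where W: "quat.unitary n W"
    and Wb: "\<forall>i<n. \<forall>j<n. W $$ (i, j) \<noteq> 0 \<longrightarrow> \<sigma> i = \<sigma> j"
    and Wf: "\<forall>i<n. (\<forall>j<n. j \<noteq> i \<longrightarrow> K $$ (i, j) = 0) \<longrightarrow>
        (\<forall>j<n. W $$ (i, j) = (if i = j then 1 else 0) \<and> W $$ (j, i) = (if i = j then 1 else 0))"
    and Wd: "\<forall>i<n. \<forall>j<n. i \<noteq> j \<longrightarrow> (quat.adj W * K * W) $$ (i, j) = 0"
    by (elim exE conjE) (rule that)
  note Wc = quat.unitary_carrier[OF W]
  have Wfix: "W $$ (i, j) = (if i = j then 1 else 0)" "W $$ (j, i) = (if i = j then 1 else 0)"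
    if "i < n" "j < n" "s \<le> i" for i j
  proof -
    have "\<forall>j<n. j \<noteq> i \<longrightarrow> K $$ (i, j) = 0" using that by (simp add: K_def)
    thus "W $$ (i, j) = (if i = j then 1 else 0)" "W $$ (j, i) = (if i = j then 1 else 0)"
      using Wf that by blast+
  qed
  define W' where "W' = mat m m (\<lambda>(i, j). if i < s \<and> j < s then W $$ (i, j) else if i = j then 1 else 0)"
  have W'c: "W' \<in> carrier_mat m m" by (simp add: W'_def)
  have W': "quat.unitary m W'"
  proof (rule quat.unitaryI[OF W'c])
    fix i j assume ij: "i < m" "j < m"
    show "(\<Sum>l<m. quat_cnj (W' $$ (l, i)) * W' $$ (l, j)) = (if i = j then 1 else 0)"
    proof (cases "i < s \<and> j < s")
      case True
      have "(\<Sum>l<m. quat_cnj (W' $$ (l, i)) * W' $$ (l, j)) = (\<Sum>l<s. quat_cnj (W $$ (l, i)) * W $$ (l, j))"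
        using s True by (intro sum.mono_neutral_cong_right) (auto simp: W'_def)
      also have "\<dots> = (\<Sum>l<n. quat_cnj (W $$ (l, i)) * W $$ (l, j))"
        using s True by (intro sum.mono_neutral_left) (auto simp: Wfix)
      also have "\<dots> = (if i = j then 1 else 0)"
        using True s by (intro quat.unitary_sum[OF W]) auto
      finally show ?thesis .
    next
      case False
      have "(\<Sum>l<m. quat_cnj (W' $$ (l, i)) * W' $$ (l, j))
        = (\<Sum>l<m. if l = (if i < s then j else i) then if i = j then 1 else 0 else 0)"
        using ij False by (intro sum.cong) (auto simp: W'_def)
      thus ?thesis using ij by simp
    qed
  qed
  have SW: "S * W = W' * S"
  proof (rule eq_matI)
    fix i j assume "i < dim_row (W' * S)" "j < dim_col (W' * S)"
    hence ij: "i < m" "j < n" by (simp_all add: S_def W'_def)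
    have "(if i < n then of_real (\<sigma> i) * W $$ (i, j) else 0) = (if j < m then W' $$ (i, j) * of_real (\<sigma> j) else 0)"
    proof (cases "i < s \<and> j < s")
      case True
      have "\<sigma> i *\<^sub>R W $$ (i, j) = \<sigma> j *\<^sub>R W $$ (i, j)"
      proof (cases "W $$ (i, j) = 0")
        case False
        hence "\<sigma> i = \<sigma> j" using Wb True s by auto
        thus ?thesis by simp
      qed simp
      thus ?thesis using True s ij by (simp add: W'_def of_real_mult_quat)
    next
      case False
      thus ?thesis using ij s by (auto simp: W'_def \<sigma>_0 Wfix not_less)
    qed
    thus "(S * W) $$ (i, j) = (W' * S) $$ (i, j)"
      unfolding S_def diag_rect_mult_index[OF Wc ij] mult_diag_rect_index[OF W'c ij] .
  qed (use Wc in \<open>simp_all add: S_def W'_def\<close>)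
  define C2 where "C2 = quat.adj W' * C1 * W"
  have C2c: "C2 \<in> carrier_mat m n" unfolding C2_def using C1c Wc W'c by auto
  have C2_herm: "C2 $$ (i, j) + quat_cnj (C2 $$ (j, i)) = 0"
    if ij: "i < s" "j < s" "i \<noteq> j" "\<sigma> i = \<sigma> j" for i j
  proof -
    have C2s: "C2 $$ (i, j) = (\<Sum>k<s. \<Sum>l<s. quat_cnj (W $$ (k, i)) * C1 $$ (k, l) * W $$ (l, j))"
      if ij: "i < s" "j < s" for i j
    proof -
      have ij': "i < m" "j < n" "i < n" using ij s by auto
      have "C2 $$ (i, j) = (\<Sum>k<m. \<Sum>l<n. quat_cnj (W' $$ (k, i)) * C1 $$ (k, l) * W $$ (l, j))"
        unfolding C2_def by (rule quat.conj_index[OF W'c C1c Wc ij'(1,2)])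
      also have "\<dots> = (\<Sum>k<s. \<Sum>l<n. quat_cnj (W $$ (k, i)) * C1 $$ (k, l) * W $$ (l, j))"
        using s ij by (intro sum.mono_neutral_cong_right) (auto simp: W'_def)
      also have "\<dots> = (\<Sum>k<s. \<Sum>l<s. quat_cnj (W $$ (k, i)) * C1 $$ (k, l) * W $$ (l, j))"
        using s ij by (intro sum.cong refl sum.mono_neutral_right) (auto simp: Wfix)
      finally show ?thesis .
    qed
    have ijn: "i < n" "j < n" using ij s by auto
    have "quat_cnj (C2 $$ (j, i))
      = (\<Sum>k<s. \<Sum>l<s. quat_cnj (W $$ (l, i)) * quat_cnj (C1 $$ (k, l)) * W $$ (k, j))"
      unfolding C2s[OF ij(2,1)] by (simp add: quat.cnj_sum quat_cnj_mult mult.assoc)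
    also have "\<dots> = (\<Sum>k<s. \<Sum>l<s. quat_cnj (W $$ (k, i)) * quat_cnj (C1 $$ (l, k)) * W $$ (l, j))"
      by (rule sum.swap)
    finally have "C2 $$ (i, j) + quat_cnj (C2 $$ (j, i))
      = (\<Sum>k<s. \<Sum>l<s. quat_cnj (W $$ (k, i)) * (C1 $$ (k, l) + quat_cnj (C1 $$ (l, k))) * W $$ (l, j))"
      unfolding C2s[OF ij(1,2)] by (simp only: sum.distrib[symmetric] distrib_left distrib_right)
    also have "\<dots> = (\<Sum>k<s. \<Sum>l<s. quat_cnj (W $$ (k, i)) * K $$ (k, l) * W $$ (l, j))"
    proof (intro sum.cong refl)
      fix k l assume "k \<in> {..<s}" "l \<in> {..<s}"
      hence kl: "k < s" "l < s" "k < n" "l < n" using s by auto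
      show "quat_cnj (W $$ (k, i)) * (C1 $$ (k, l) + quat_cnj (C1 $$ (l, k))) * W $$ (l, j)
        = quat_cnj (W $$ (k, i)) * K $$ (k, l) * W $$ (l, j)"
      proof (cases "W $$ (k, i) = 0 \<or> W $$ (l, j) = 0")
        case False
        hence "\<sigma> k = \<sigma> l" using Wb kl ijn ij(4) by metis
        thus ?thesis using kl by (simp add: K_def)
      qed auto
    qed
    also have "\<dots> = (\<Sum>k<s. \<Sum>l<n. quat_cnj (W $$ (k, i)) * K $$ (k, l) * W $$ (l, j))"
      using s by (intro sum.cong refl sum.mono_neutral_left) (auto simp: K_def)
    also have "\<dots> = (\<Sum>k<n. \<Sum>l<n. quat_cnj (W $$ (k, i)) * K $$ (k, l) * W $$ (l, j))"
      using s by (intro sum.mono_neutral_left) (auto simp: K_def)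
    also have "\<dots> = (quat.adj W * K * W) $$ (i, j)"
      by (rule quat.conj_index[OF Wc Kc Wc ijn, symmetric])
    also have "\<dots> = 0" using Wd ijn ij(3) by blast
    finally show ?thesis .
  qed
  define N where "N = mat m n (\<lambda>(i, j). if s \<le> i \<and> s \<le> j then C2 $$ (i, j) else 0)"
  have Nc: "N \<in> carrier_mat m n" by (simp add: N_def)
  obtain V3 U3 t where V3: "quat.unitary m V3" and U3: "quat.unitary n U3"
    and f: "fixes_below s m V3" "fixes_below s n U3"
    and off3: "\<And>i j. i < m \<Longrightarrow> j < n \<Longrightarrow> i \<noteq> j \<Longrightarrow> (quat.adj V3 * N * U3) $$ (i, j) = 0"
    and pos3: "\<And>j. s \<le> j \<Longrightarrow> j < t \<Longrightarrow> \<exists>c>0. (quat.adj V3 * N * U3) $$ (j, j) = of_real c"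
    and zero3: "\<And>j. t \<le> j \<Longrightarrow> j < min m n \<Longrightarrow> (quat.adj V3 * N * U3) $$ (j, j) = 0"
  proof -
    have "s \<le> m" "s \<le> n" using s by auto
    moreover have "N $$ (i, j) = 0" if "i < m" "j < n" "i < s \<or> j < s" for i j
      using that by (auto simp: N_def)
    ultimately show thesis using quat_svd_from[OF Nc, of s] that by metis
  qed
  note V3c = quat.unitary_carrier[OF V3] and U3c = quat.unitary_carrier[OF U3]
  have SU: "S * U3 = V3 * S"
  proof (rule eq_matI)
    fix i j assume "i < dim_row (V3 * S)" "j < dim_col (V3 * S)"
    hence ij: "i < m" "j < n" using V3c by (simp_all add: S_def)
    have "(if i < n then of_real (\<sigma> i) * U3 $$ (i, j) else 0) = (if j < m then V3 $$ (i, j) * of_real (\<sigma> j) else 0)"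
      using f ij s by (cases "i < s"; cases "j < s") (auto simp: \<sigma>_0 fixes_below_def)
    thus "(S * U3) $$ (i, j) = (V3 * S) $$ (i, j)"
      unfolding S_def diag_rect_mult_index[OF U3c ij] mult_diag_rect_index[OF V3c ij] .
  qed (use U3c V3c in \<open>simp_all add: S_def\<close>)
  define C3 where "C3 = quat.adj V3 * C2 * U3"
  have C3_lo: "C3 $$ (i, j) = C2 $$ (i, j)" if ij: "i < s" "j < s" for i j
  proof -
    have ij': "i < m" "j < n" using ij s by auto
    have "C3 $$ (i, j) = (\<Sum>k<m. \<Sum>l<n. if l = j then if k = i then C2 $$ (i, j) else 0 else 0)"
      unfolding C3_def quat.conj_index[OF V3c C2c U3c ij']
      using f ij ij' by (intro sum.cong refl) (auto simp: fixes_below_def)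
    thus ?thesis using ij' by simp
  qed
  have C3_hi: "C3 $$ (i, j) = (quat.adj V3 * N * U3) $$ (i, j)"
    if ij: "i < m" "j < n" "s \<le> i" "s \<le> j" for i j
    unfolding C3_def quat.conj_index[OF V3c C2c U3c ij(1,2)] quat.conj_index[OF V3c Nc U3c ij(1,2)]
    using f ij by (intro sum.cong refl) (auto simp: fixes_below_def N_def)
  have c: "V1 * W' \<in> carrier_mat m m" "U1 * W \<in> carrier_mat n n" using V1c W'c U1c Wc by auto
  have eqE: "quat.adj (V1 * W' * V3) * E * (U1 * W * U3) = C3"
    unfolding quat.conj_mult_mult[OF c(1) V3c E c(2) U3c] quat.conj_mult_mult[OF V1c W'c E U1c Wc]
      C3_def C2_def C1_def ..
  have eqA: "quat.adj (V1 * W' * V3) * A * (U1 * W * U3) = S"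
    unfolding quat.conj_mult_mult[OF c(1) V3c A c(2) U3c] quat.conj_mult_mult[OF V1c W'c A U1c Wc]
      S quat_intertwine_conj[OF W' Sc Wc SW] by (rule quat_intertwine_conj[OF V3 Sc U3c SU])
  show thesis
  proof (rule that[of "V1 * W' * V3" "U1 * W * U3" \<sigma>], unfold eqE eqA)
    show "quat.unitary m (V1 * W' * V3)" "quat.unitary n (U1 * W * U3)"
      by (intro quat.unitary_mult V1 W' V3 U1 W U3)+
    show "0 \<le> \<sigma> i" for i using \<sigma>_pos[of i] \<sigma>_0[of i] by (cases "i < s") auto
    show "\<sigma> i = 0" if "min m n \<le> i" for i using that s by (intro \<sigma>_0) linarith
    show "S = diag_rect m n (\<lambda>i. of_real (\<sigma> i))" by (simp add: S_def)
    show "C3 $$ (i, j) + quat_cnj (C3 $$ (j, i)) = 0"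
      if "i < min m n" "j < min m n" "i \<noteq> j" "\<sigma> i = \<sigma> j" "\<sigma> i \<noteq> 0" for i j
    proof -
      have "i < s" "j < s" using that \<sigma>_0 by (metis not_le)+
      thus ?thesis using C2_herm that C3_lo by simp
    qed
    show "C3 $$ (i, j) = 0" if "i < m" "j < n" "i \<noteq> j" "\<sigma> i = 0" "\<sigma> j = 0" for i j
    proof -
      have "s \<le> i" "s \<le> j" using that \<sigma>_pos by (metis less_irrefl not_le)+
      thus ?thesis using C3_hi off3 that by simp
    qed
    show "\<exists>c\<ge>0. C3 $$ (i, i) = of_real c" if "i < min m n" "\<sigma> i = 0" for i
    proof -
      have "s \<le> i" using that \<sigma>_pos by (metis less_irrefl not_le)
      hence eq: "C3 $$ (i, i) = (quat.adj V3 * N * U3) $$ (i, i)" using C3_hi that by simp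
      show ?thesis
      proof (cases "i < t")
        case True
        thus ?thesis using pos3[OF \<open>s \<le> i\<close> True] eq by (metis less_imp_le)
      next
        case False
        hence "C3 $$ (i, i) = of_real 0" using zero3[of i] that eq by simp
        thus ?thesis by blast
      qed
    qed
  qed
qed

section \<open>First-order correction\<close>

definition dual_mat :: "'a mat \<Rightarrow> 'a mat \<Rightarrow> 'a dual mat" where
  "dual_mat A E = mat (dim_row A) (dim_col A) (\<lambda>ij. Dual (A $$ ij) (E $$ ij))"

lemma dual_mat_carrier [simp]: "A \<in> carrier_mat m n \<Longrightarrow> dual_mat A E \<in> carrier_mat m n"
  by (auto simp: dual_mat_def)

lemma st_dual_mat: "A \<in> carrier_mat m n \<Longrightarrow> map_mat st_part (dual_mat A E) = A"
  by (intro eq_matI) (auto simp: dual_mat_def)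

lemma inf_dual_mat:
  "A \<in> carrier_mat m n \<Longrightarrow> E \<in> carrier_mat m n \<Longrightarrow> map_mat inf_part (dual_mat A E) = E"
  by (intro eq_matI) (auto simp: dual_mat_def)

lemma dual_mat_eqI:
  assumes "A \<in> carrier_mat m n" "B \<in> carrier_mat m n"
    and "map_mat st_part A = map_mat st_part B" "map_mat inf_part A = map_mat inf_part B"
  shows "A = B"
proof (rule eq_matI)
  fix i j assume "i < dim_row B" "j < dim_col B"
  hence ij: "i < m" "j < n" using assms by auto
  have "st_part (A $$ (i, j)) = st_part (B $$ (i, j))"
    using arg_cong[OF assms(3), of "\<lambda>M. M $$ (i, j)"] ij assms(1,2) by simp
  moreover have "inf_part (A $$ (i, j)) = inf_part (B $$ (i, j))"
    using arg_cong[OF assms(4), of "\<lambda>M. M $$ (i, j)"] ij assms(1,2) by simp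
  ultimately show "A $$ (i, j) = B $$ (i, j)" by (simp add: dual_eq_iff)
qed (use assms in auto)

lemma st_part_mult_mat:
  fixes A B :: "'a :: ring_1 dual mat"
  assumes A: "A \<in> carrier_mat m k" and B: "B \<in> carrier_mat k n"
  shows "map_mat st_part (A * B) = map_mat st_part A * map_mat st_part B"
proof (rule eq_matI)
  fix i j assume "i < dim_row (map_mat st_part A * map_mat st_part B)"
    "j < dim_col (map_mat st_part A * map_mat st_part B)"
  hence ij: "i < m" "j < n" using A B by auto
  have c: "map_mat st_part A \<in> carrier_mat m k" "map_mat st_part B \<in> carrier_mat k n"
    using A B by auto
  have "map_mat st_part (A * B) $$ (i, j) = st_part ((A * B) $$ (i, j))"
    using ij A B by (intro index_map_mat) auto
  also have "\<dots> = (\<Sum>l<k. st_part (A $$ (i, l)) * st_part (B $$ (l, j)))"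
    unfolding index_mult_mat_sum[OF A B ij] by (simp add: dual_sel_sum)
  also have "\<dots> = (map_mat st_part A * map_mat st_part B) $$ (i, j)"
    unfolding index_mult_mat_sum[OF c ij] using A B ij by (intro sum.cong) auto
  finally show "map_mat st_part (A * B) $$ (i, j) = (map_mat st_part A * map_mat st_part B) $$ (i, j)" .
qed (use A B in auto)

lemma inf_part_mult_mat:
  fixes A B :: "'a :: ring_1 dual mat"
  assumes A: "A \<in> carrier_mat m k" and B: "B \<in> carrier_mat k n"
  shows "map_mat inf_part (A * B)
    = map_mat st_part A * map_mat inf_part B + map_mat inf_part A * map_mat st_part B" (is "_ = ?R")
proof (rule eq_matI)
  fix i j assume "i < dim_row ?R" "j < dim_col ?R"
  hence ij: "i < m" "j < n" using A B by auto
  have c: "map_mat st_part A \<in> carrier_mat m k" "map_mat st_part B \<in> carrier_mat k n"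
    "map_mat inf_part A \<in> carrier_mat m k" "map_mat inf_part B \<in> carrier_mat k n"
    using A B by auto
  have "map_mat inf_part (A * B) $$ (i, j) = inf_part ((A * B) $$ (i, j))"
    using ij A B by (intro index_map_mat) auto
  also have "\<dots> = (\<Sum>l<k. st_part (A $$ (i, l)) * inf_part (B $$ (l, j)))
      + (\<Sum>l<k. inf_part (A $$ (i, l)) * st_part (B $$ (l, j)))"
    unfolding index_mult_mat_sum[OF A B ij] by (simp add: dual_sel_sum sum.distrib)
  also have "\<dots> = (map_mat st_part A * map_mat inf_part B) $$ (i, j)
      + (map_mat inf_part A * map_mat st_part B) $$ (i, j)"
    unfolding index_mult_mat_sum[OF c(1,4) ij] index_mult_mat_sum[OF c(3,2) ij] using A B ij
    by (intro arg_cong2[where f = "(+)"] sum.cong) auto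
  also have "\<dots> = ?R $$ (i, j)" using A B ij by (intro index_add_mat(1)[symmetric]) auto
  finally show "map_mat inf_part (A * B) $$ (i, j) = ?R $$ (i, j)" .
qed (use A B in auto)

lemma st_part_adj: "map_mat st_part (dq.adj A) = quat.adj (map_mat st_part A)"
  and inf_part_adj: "map_mat inf_part (dq.adj A) = quat.adj (map_mat inf_part A)"
  by (intro eq_matI; simp)+

lemma st_part_one_mat: "map_mat st_part (1\<^sub>m n :: 'a :: ring_1 dual mat) = 1\<^sub>m n"
  and inf_part_one_mat: "map_mat inf_part (1\<^sub>m n :: 'a :: ring_1 dual mat) = 0\<^sub>m n n"
  by (intro eq_matI; simp)+

lemma quat_unitary_st_part:
  assumes "dq.unitary n U"
  shows "quat.unitary n (map_mat st_part U)"
proof -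
  note c = dq.unitary_carrier[OF assms]
  have "map_mat st_part (dq.adj U * U) = 1\<^sub>m n"
    using assms by (simp add: dq.unitary_def st_part_one_mat)
  thus ?thesis
    using c st_part_mult_mat[OF dq.adj_carrier[OF c] c] by (simp add: quat.unitary_def st_part_adj)
qed

text \<open>\<open>dual_mat U (U * P)\<close> is \<open>U (I + \<epsilon> P)\<close>.\<close>

lemma dq_unitary_first_order:
  assumes U: "quat.unitary n U" and P: "P \<in> carrier_mat n n"
    and anti: "\<And>i j. i < n \<Longrightarrow> j < n \<Longrightarrow> quat_cnj (P $$ (j, i)) = - P $$ (i, j)"
  shows "dq.unitary n (dual_mat U (U * P))"
proof -
  note Uc = quat.unitary_carrier[OF U]
  have UP: "U * P \<in> carrier_mat n n" using Uc P by auto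
  let ?V = "dual_mat U (U * P)"
  have Vc: "?V \<in> carrier_mat n n" using Uc by simp
  have Ui: "quat.adj U * U = 1\<^sub>m n" using U by (simp add: quat.unitary_def)
  have 1: "quat.adj U * (U * P) = P"
    using assoc_mult_mat[OF quat.adj_carrier[OF Uc] Uc P] P by (simp add: Ui)
  have 2: "quat.adj (U * P) * U = quat.adj P"
    using assoc_mult_mat[OF quat.adj_carrier[OF P] quat.adj_carrier[OF Uc] Uc] P
    by (simp add: Ui quat.adj_mult[OF Uc P])
  have "dq.adj ?V * ?V = 1\<^sub>m n"
  proof (rule dual_mat_eqI[of _ n n])
    show "dq.adj ?V * ?V \<in> carrier_mat n n" using Vc by auto
    show "map_mat st_part (dq.adj ?V * ?V) = map_mat st_part (1\<^sub>m n)"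
      by (simp add: st_part_mult_mat[OF dq.adj_carrier[OF Vc] Vc] st_part_adj st_dual_mat[OF Uc]
          Ui st_part_one_mat)
    have "P + quat.adj P = 0\<^sub>m n n"
      using P anti by (intro eq_matI) auto
    thus "map_mat inf_part (dq.adj ?V * ?V) = map_mat inf_part (1\<^sub>m n)"
      by (simp add: inf_part_mult_mat[OF dq.adj_carrier[OF Vc] Vc] st_part_adj inf_part_adj
          st_dual_mat[OF Uc] inf_dual_mat[OF Uc UP] 1 2 inf_part_one_mat)
  qed simp
  thus ?thesis using Vc by (simp add: dq.unitary_def)
qed

lemma first_order_conj:
  assumes B: "B \<in> carrier_mat m n"
    and V: "quat.unitary m V" and U: "quat.unitary n U"
    and P: "P \<in> carrier_mat m m" and Q: "Q \<in> carrier_mat n n"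
    and S: "quat.adj V * map_mat st_part B * U = S"
  shows "map_mat st_part (dq.adj (dual_mat V (V * P)) * B * dual_mat U (U * Q)) = S" (is "map_mat _ ?M = _")
    and "map_mat inf_part (dq.adj (dual_mat V (V * P)) * B * dual_mat U (U * Q))
      = S * Q + (quat.adj V * map_mat inf_part B * U + quat.adj P * S)"
proof -
  let ?A = "map_mat st_part B" and ?E = "map_mat inf_part B"
  note Vc = quat.unitary_carrier[OF V] and Uc = quat.unitary_carrier[OF U]
  have AE: "?A \<in> carrier_mat m n" "?E \<in> carrier_mat m n" using B by auto
  have VP: "V * P \<in> carrier_mat m m" and UQ: "U * Q \<in> carrier_mat n n" using Vc Uc P Q by auto
  have Vd: "dq.adj (dual_mat V (V * P)) \<in> carrier_mat m m" using Vc by auto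
  have Ud: "dual_mat U (U * Q) \<in> carrier_mat n n" using Uc by auto
  have VB: "dq.adj (dual_mat V (V * P)) * B \<in> carrier_mat m n" using Vd B by auto
  have adjs: "quat.adj V \<in> carrier_mat m m" "quat.adj P \<in> carrier_mat m m" using Vc P by auto
  have VA: "quat.adj V * ?A \<in> carrier_mat m n" using adjs AE by auto
  have stVB: "map_mat st_part (dq.adj (dual_mat V (V * P)) * B) = quat.adj V * ?A"
    by (simp add: st_part_mult_mat[OF Vd B] st_part_adj st_dual_mat[OF Vc])
  have infVB: "map_mat inf_part (dq.adj (dual_mat V (V * P)) * B)
      = quat.adj V * ?E + quat.adj P * quat.adj V * ?A"
    by (simp add: inf_part_mult_mat[OF Vd B] st_part_adj inf_part_adj st_dual_mat[OF Vc]
        inf_dual_mat[OF Vc VP] quat.adj_mult[OF Vc P])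
  show "map_mat st_part ?M = S"
    by (simp add: st_part_mult_mat[OF VB Ud] stVB st_dual_mat[OF Uc] S)
  have "map_mat inf_part ?M = quat.adj V * ?A * (U * Q)
      + (quat.adj V * ?E + quat.adj P * quat.adj V * ?A) * U"
    by (simp add: inf_part_mult_mat[OF VB Ud] stVB infVB st_dual_mat[OF Uc] inf_dual_mat[OF Uc UQ])
  also have "quat.adj V * ?A * (U * Q) = S * Q"
    using assoc_mult_mat[OF VA Uc Q] by (simp only: S)
  also have "(quat.adj V * ?E + quat.adj P * quat.adj V * ?A) * U
      = quat.adj V * ?E * U + quat.adj P * quat.adj V * ?A * U"
    using adjs AE Uc by (intro add_mult_distrib_mat[of _ m n _ _ n] mult_carrier_mat[of _ m m])
      (auto intro!: mult_carrier_mat[of _ m m])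
  also have "quat.adj P * quat.adj V * ?A = quat.adj P * (quat.adj V * ?A)"
    by (rule assoc_mult_mat[OF adjs(2,1) AE(1)])
  also have "quat.adj P * (quat.adj V * ?A) * U = quat.adj P * S"
    using assoc_mult_mat[OF adjs(2) VA Uc] by (simp only: S)
  finally show "map_mat inf_part ?M = S * Q + (quat.adj V * ?E * U + quat.adj P * S)" .
qed

lemma dq_of_dual_sel [simp]:
  "st_part (dq_of_dual x) = of_real (st_part x)" "inf_part (dq_of_dual x) = of_real (inf_part x)"
  by (simp_all add: dq_of_dual_def dual.map_sel)

text \<open>Off the diagonal, the \<open>\<epsilon>\<close>-part \<open>C\<close> is cancelled by anti-Hermitian \<open>P\<close>, \<open>Q\<close> solving
  \<open>\<Sigma> Q - P \<Sigma> = - C\<close>: the \<open>(i, j)\<close> and \<open>(j, i)\<close> entries form a linear system with determinant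
  \<open>\<sigma>\<^sub>i\<^sup>2 - \<sigma>\<^sub>j\<^sup>2\<close>. If \<open>\<sigma>\<^sub>i = \<sigma>\<^sub>j \<noteq> 0\<close>, taking \<open>P\<^sub>i\<^sub>j = 0\<close> removes the anti-Hermitian part.\<close>

lemma dq_svd_unordered:
  assumes B: "B \<in> carrier_mat m n"
  obtains V U \<mu> where "dq.unitary m V" "dq.unitary n U"
    "dq.adj V * B * U = diag_rect m n (\<lambda>i. dq_of_dual (\<mu> i))" "\<And>i. i < min m n \<Longrightarrow> 0 \<le> \<mu> i"
proof (rule quat_svd_with_perturbation[of "map_mat st_part B" m n "map_mat inf_part B"])
  fix V U \<sigma> assume V: "quat.unitary m V" and U: "quat.unitary n U"
    and \<sigma>: "\<And>i. 0 \<le> \<sigma> i" "\<And>i. min m n \<le> i \<Longrightarrow> \<sigma> i = 0"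
    and S: "quat.adj V * map_mat st_part B * U = diag_rect m n (\<lambda>i. of_real (\<sigma> i))"
    and C_pos: "\<And>i j. i < min m n \<Longrightarrow> j < min m n \<Longrightarrow> i \<noteq> j \<Longrightarrow> \<sigma> i = \<sigma> j \<Longrightarrow> \<sigma> i \<noteq> 0 \<Longrightarrow>
      (quat.adj V * map_mat inf_part B * U) $$ (i, j)
        + quat_cnj ((quat.adj V * map_mat inf_part B * U) $$ (j, i)) = 0"
    and C_0: "\<And>i j. i < m \<Longrightarrow> j < n \<Longrightarrow> i \<noteq> j \<Longrightarrow> \<sigma> i = 0 \<Longrightarrow> \<sigma> j = 0 \<Longrightarrow>
      (quat.adj V * map_mat inf_part B * U) $$ (i, j) = 0"
    and C_diag: "\<And>i. i < min m n \<Longrightarrow> \<sigma> i = 0 \<Longrightarrow>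
      \<exists>c\<ge>0. (quat.adj V * map_mat inf_part B * U) $$ (i, i) = of_real c"
  note Vc = quat.unitary_carrier[OF V] and Uc = quat.unitary_carrier[OF U]
  define C where "C = quat.adj V * map_mat inf_part B * U"
  have Cc: "C \<in> carrier_mat m n" unfolding C_def using Vc Uc B by auto
  define c where "c i j = (if i < m \<and> j < n then C $$ (i, j) else 0)" for i j
  define p where "p i j = (if \<sigma> i = \<sigma> j then 0
    else (1 / ((\<sigma> i)\<^sup>2 - (\<sigma> j)\<^sup>2)) *\<^sub>R (- (\<sigma> j *\<^sub>R c i j) - \<sigma> i *\<^sub>R quat_cnj (c j i)))" for i j
  define q where "q i j = (if \<sigma> i = \<sigma> j then (- 1 / (2 * \<sigma> i)) *\<^sub>R (c i j - quat_cnj (c j i))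
    else (1 / ((\<sigma> i)\<^sup>2 - (\<sigma> j)\<^sup>2)) *\<^sub>R (- (\<sigma> i *\<^sub>R c i j) - \<sigma> j *\<^sub>R quat_cnj (c j i)))" for i j
  have flip: "1 / ((\<sigma> j)\<^sup>2 - (\<sigma> i)\<^sup>2) = - (1 / ((\<sigma> i)\<^sup>2 - (\<sigma> j)\<^sup>2))" for i j
    by (metis minus_diff_eq minus_divide_right)
  have p_anti: "quat_cnj (p j i) = - p i j" for i j
    unfolding p_def flip[of i j] by (simp add: quat_eq_iff algebra_simps)
  have q_anti: "quat_cnj (q j i) = - q i j" for i j
    unfolding q_def flip[of i j] by (simp add: quat_eq_iff algebra_simps)
  define P Q where "P = mat m m (\<lambda>(i, j). p i j)" and "Q = mat n n (\<lambda>(i, j). q i j)"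
  have Pc: "P \<in> carrier_mat m m" and Qc: "Q \<in> carrier_mat n n" by (simp_all add: P_def Q_def)
  define S' where "S' = diag_rect m n (\<lambda>i. of_real (\<sigma> i) :: quat)"
  define \<mu> where "\<mu> i = Dual (\<sigma> i) (q_re (c i i))" for i
  let ?V = "dual_mat V (V * P)" and ?U = "dual_mat U (U * Q)"
  have key: "\<sigma> i *\<^sub>R q i j + c i j - \<sigma> j *\<^sub>R p i j = (if i = j then of_real (q_re (c i i)) else 0)"
    if ij: "i < m" "j < n" for i j
  proof (cases "\<sigma> i = \<sigma> j")
    case True
    show ?thesis
    proof (cases "\<sigma> i = 0")
      case True
      show ?thesis
      proof (cases "i = j")
        case True
        then obtain a where "C $$ (i, j) = of_real a" using C_diag[of i] ij \<open>\<sigma> i = 0\<close> by (auto simp: C_def)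
        thus ?thesis using True ij \<open>\<sigma> i = 0\<close> by (simp add: c_def)
      next
        case False
        thus ?thesis using True \<open>\<sigma> i = \<sigma> j\<close> ij C_0 by (simp add: c_def C_def)
      qed
    next
      case False
      have mn: "i < min m n" "j < min m n" using False \<open>\<sigma> i = \<sigma> j\<close> \<sigma>(2) by (metis not_le)+
      have "\<sigma> i *\<^sub>R q i j + c i j - \<sigma> j *\<^sub>R p i j = (1 / 2) *\<^sub>R (c i j + quat_cnj (c j i))"
        using True False by (simp add: q_def p_def quat_eq_iff field_simps)
      also have "\<dots> = (if i = j then of_real (q_re (c i i)) else 0)"
      proof (cases "i = j")
        case True
        thus ?thesis by (simp add: quat_eq_iff)
      next
        case False
        thus ?thesis using C_pos[OF mn False \<open>\<sigma> i = \<sigma> j\<close> \<open>\<sigma> i \<noteq> 0\<close>] mn by (simp add: c_def C_def)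
      qed
      finally show ?thesis .
    qed
  next
    case False
    hence nz: "(\<sigma> i)\<^sup>2 - (\<sigma> j)\<^sup>2 \<noteq> 0" using \<sigma>(1) by (simp add: power2_eq_iff_nonneg)
    define D where "D = (\<sigma> i)\<^sup>2 - (\<sigma> j)\<^sup>2"
    have solve: "x *\<^sub>R ((1 / D) *\<^sub>R (- (x *\<^sub>R a) - y *\<^sub>R b)) + a
        - y *\<^sub>R ((1 / D) *\<^sub>R (- (y *\<^sub>R a) - x *\<^sub>R b)) = 0"
      if "D = x\<^sup>2 - y\<^sup>2" for x y and a b :: quat
    proof -
      let ?X = "- (x *\<^sub>R a) - y *\<^sub>R b" and ?Y = "- (y *\<^sub>R a) - x *\<^sub>R b"
      have "x *\<^sub>R ?X - y *\<^sub>R ?Y = - (D *\<^sub>R a)"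
        by (simp add: that power2_eq_square algebra_simps)
      hence "(1 / D) *\<^sub>R (x *\<^sub>R ?X - y *\<^sub>R ?Y) = (1 / D) *\<^sub>R (- (D *\<^sub>R a))"
        by simp
      also have "\<dots> = - a" using nz by (simp add: D_def)
      finally have "(1 / D) *\<^sub>R (x *\<^sub>R ?X) - (1 / D) *\<^sub>R (y *\<^sub>R ?Y) = - a"
        by (simp only: scaleR_right_diff_distrib)
      thus ?thesis by (simp only: scaleR_left_commute[of _ "1 / D"]) (simp add: algebra_simps)
    qed
    have "\<sigma> i *\<^sub>R q i j + c i j - \<sigma> j *\<^sub>R p i j = 0"
      using solve[OF D_def, of "c i j" "quat_cnj (c j i)"] False
      by (simp only: q_def p_def D_def[symmetric] if_False)
    thus ?thesis using False by auto
  qed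
  have inf_entries: "S' * Q + (C + quat.adj P * S') = diag_rect m n (\<lambda>i. of_real (inf_part (\<mu> i)))"
    (is "?L = ?R")
  proof (rule eq_matI)
    fix i j assume "i < dim_row ?R" "j < dim_col ?R"
    hence ij: "i < m" "j < n" by simp_all
    have 1: "(S' * Q) $$ (i, j) = \<sigma> i *\<^sub>R q i j"
      unfolding S'_def diag_rect_mult_index[OF Qc ij] using ij \<sigma>(2)[of i]
      by (simp add: Q_def of_real_mult_quat)
    have 2: "(quat.adj P * S') $$ (i, j) = - (\<sigma> j *\<^sub>R p i j)"
      unfolding S'_def mult_diag_rect_index[OF quat.adj_carrier[OF Pc] ij] using ij \<sigma>(2)[of j]
      by (simp add: P_def of_real_mult_quat p_anti)
    have "?L $$ (i, j) = (S' * Q) $$ (i, j) + (C $$ (i, j) + (quat.adj P * S') $$ (i, j))"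
      using ij Cc Pc by (simp add: S'_def del: index_mult_mat(1))
    also have "\<dots> = ?R $$ (i, j)"
      unfolding 1 2 using key[OF ij] ij by (auto simp: c_def[of i j] \<mu>_def add_diff_eq)
    finally show "?L $$ (i, j) = ?R $$ (i, j)" .
  qed (use Pc Qc in \<open>simp_all add: S'_def\<close>)
  show thesis
  proof (rule that[of ?V ?U \<mu>])
    show VV: "dq.unitary m ?V"
      by (rule dq_unitary_first_order[OF V Pc]) (simp add: P_def p_anti)
    show UU: "dq.unitary n ?U"
      by (rule dq_unitary_first_order[OF U Qc]) (simp add: Q_def q_anti)
    show "dq.adj ?V * B * ?U = diag_rect m n (\<lambda>i. dq_of_dual (\<mu> i))"
    proof (rule dual_mat_eqI[of _ m n])
      show "dq.adj ?V * B * ?U \<in> carrier_mat m n"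
        using dq.unitary_carrier[OF VV] dq.unitary_carrier[OF UU] B by auto
      show "map_mat st_part (dq.adj ?V * B * ?U) = map_mat st_part (diag_rect m n (\<lambda>i. dq_of_dual (\<mu> i)))"
        unfolding first_order_conj(1)[OF B V U Pc Qc S]
        by (rule eq_matI) (auto simp: \<mu>_def)
      have "map_mat inf_part (dq.adj ?V * B * ?U) = S' * Q + (C + quat.adj P * S')"
        unfolding first_order_conj(2)[OF B V U Pc Qc S] S'_def C_def ..
      thus "map_mat inf_part (dq.adj ?V * B * ?U) = map_mat inf_part (diag_rect m n (\<lambda>i. dq_of_dual (\<mu> i)))"
        unfolding inf_entries by (auto intro!: eq_matI)
    qed simp
    show "0 \<le> \<mu> i" if i: "i < min m n" for i
    proof (cases "\<sigma> i = 0")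
      case True
      then obtain a where "a \<ge> 0" "C $$ (i, i) = of_real a" using C_diag[OF i] by (auto simp: C_def)
      thus ?thesis using i True by (simp add: less_eq_dual_def \<mu>_def c_def)
    next
      case False
      thus ?thesis using \<sigma>(1)[of i] by (simp add: less_eq_dual_def \<mu>_def)
    qed
  qed
qed (use B in auto)

section \<open>Existence and uniqueness\<close>

lemma dq_unitary_adj:
  assumes U: "dq.unitary n U"
  shows "dq.unitary n (dq.adj U)"
proof -
  note c = dq.unitary_carrier[OF U]
  define E where "E = U * dq.adj U"
  have Ec: "E \<in> carrier_mat n n" using c by (auto simp: E_def)
  have "E * E = U * (dq.adj U * E)"
    unfolding E_def by (rule assoc_mult_mat[OF c dq.adj_carrier[OF c]]) (use c in auto)
  also have "dq.adj U * E = dq.adj U * U * dq.adj U"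
    unfolding E_def by (rule assoc_mult_mat[OF dq.adj_carrier[OF c] c dq.adj_carrier[OF c], symmetric])
  also have "\<dots> = dq.adj U" using U c by (simp add: dq.unitary_def)
  finally have EE: "E * E = E" by (simp add: E_def)
  have st: "map_mat st_part E = 1\<^sub>m n"
    using quat_unitary_adj[OF quat_unitary_st_part[OF U]] c
    by (simp add: E_def st_part_mult_mat[OF c dq.adj_carrier[OF c]] st_part_adj quat.unitary_def)
  \<comment> \<open>An idempotent with standard part \<open>I\<close> has vanishing \<open>\<epsilon>\<close>-part \<open>E\<^sub>1\<close>, since \<open>E\<^sub>1 + E\<^sub>1 = E\<^sub>1\<close>.\<close>
  have E1: "map_mat inf_part E \<in> carrier_mat n n" using Ec by simp
  have "map_mat inf_part E = map_mat inf_part E + map_mat inf_part E"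
    using inf_part_mult_mat[OF Ec Ec] E1 unfolding EE st by simp
  hence E2: "map_mat inf_part E $$ (i, j) = map_mat inf_part E $$ (i, j) + map_mat inf_part E $$ (i, j)"
    if "i < n" "j < n" for i j
    using that E1 Ec by (metis carrier_matD index_add_mat(1))
  have "map_mat inf_part E = 0\<^sub>m n n"
    by (rule eq_matI) (use E2 Ec in auto)
  hence "E = 1\<^sub>m n"
    using st by (intro dual_mat_eqI[OF Ec]) (simp_all add: st_part_one_mat inf_part_one_mat)
  thus ?thesis using c by (simp add: dq.unitary_def E_def)
qed

lemma dq_unitary_cancel:
  assumes U: "dq.unitary n U" and X: "X \<in> carrier_mat n k"
  shows "U * (dq.adj U * X) = X"
proof -
  note c = dq.unitary_carrier[OF U]
  have "U * (dq.adj U * X) = U * dq.adj U * X"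
    by (rule assoc_mult_mat[OF c dq.adj_carrier[OF c] X, symmetric])
  thus ?thesis using dq_unitary_adj[OF U] X by (simp add: dq.unitary_def)
qed

lemma dq_intertwine_real:
  assumes eq: "q * dq_of_dual a = dq_of_dual b * q" and q: "st_part q \<noteq> 0"
  shows "a = b"
proof -
  have "st_part a *\<^sub>R st_part q = st_part b *\<^sub>R st_part q"
    using arg_cong[OF eq, of st_part] by (simp add: of_real_mult_quat)
  hence 1: "st_part a = st_part b" using q by simp
  have "inf_part a *\<^sub>R st_part q = inf_part b *\<^sub>R st_part q"
    using arg_cong[OF eq, of inf_part] 1 by (simp add: of_real_mult_quat)
  thus ?thesis using q 1 by (simp add: dual_eq_iff)
qed

text \<open>The two equations for \<open>x, y\<close> decouple for \<open>x + y\<close> and \<open>x - y\<close>.\<close>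

lemma dq_intertwine_pair:
  assumes "y * dq_of_dual b = dq_of_dual a * x" "x * dq_of_dual b = dq_of_dual a * y"
    and "0 \<le> a" "0 \<le> b" and "st_part x \<noteq> 0"
  shows "a = b"
proof -
  have neg: "dq_of_dual (- a) = - dq_of_dual a" by (simp add: dual_eq_iff)
  have p: "(x + y) * dq_of_dual b = dq_of_dual a * (x + y)"
    using assms(1,2) by (simp add: algebra_simps)
  have m: "(x - y) * dq_of_dual b = dq_of_dual (- a) * (x - y)"
    using assms(1,2) by (simp add: neg algebra_simps)
  have "st_part x + st_part x = st_part (x + y) + st_part (x - y)" by simp
  hence "st_part (x + y) \<noteq> 0 \<or> st_part (x - y) \<noteq> 0"
    using assms(5) by (metis add.right_neutral scaleR_2 scaleR_eq_0_iff zero_neq_numeral)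
  thus ?thesis
  proof
    assume "st_part (x + y) \<noteq> 0"
    thus ?thesis using dq_intertwine_real[OF p] by simp
  next
    assume "st_part (x - y) \<noteq> 0"
    hence "b = - a" by (rule dq_intertwine_real[OF m])
    thus ?thesis using assms(3,4) by (auto simp: less_eq_dual_def dual_eq_iff)
  qed
qed

lemma diag_rect_unitary_equiv:
  assumes V: "dq.unitary m V" and U: "dq.unitary n U"
    and eq: "dq.adj V * diag_rect m n (\<lambda>i. dq_of_dual (f i)) * U = diag_rect m n (\<lambda>i. dq_of_dual (g i))"
    and f: "\<And>i. 0 \<le> f i" "\<And>i. min m n \<le> i \<Longrightarrow> f i = 0"
    and g: "\<And>i. 0 \<le> g i" "\<And>i. min m n \<le> i \<Longrightarrow> g i = 0"
    and ij: "i < n" "j < n" and nz: "st_part (U $$ (i, j)) \<noteq> 0"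
  shows "f i = g j"
proof -
  note Vc = dq.unitary_carrier[OF V] and Uc = dq.unitary_carrier[OF U]
  define S where "S k l h = diag_rect k l (\<lambda>i. dq_of_dual (h i))" for k l and h :: "nat \<Rightarrow> real dual"
  have Sc: "S k l h \<in> carrier_mat k l" for k l h by (simp add: S_def)
  have S_adj: "dq.adj (S m n h) = S n m h" for h
    by (rule eq_matI) (auto simp: S_def dual_eq_iff)
  have eq: "dq.adj V * S m n f * U = S m n g" using eq by (simp add: S_def)
  have "V * S m n g = V * (dq.adj V * (S m n f * U))"
    unfolding eq[symmetric] assoc_mult_mat[OF dq.adj_carrier[OF Vc] Sc Uc] ..
  also have "\<dots> = S m n f * U"
    by (rule dq_unitary_cancel[OF V mult_carrier_mat[OF Sc Uc]])
  finally have eq1: "V * S m n g = S m n f * U" .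
  have "S n m g = dq.adj U * S n m f * V"
    using dq.adj_conj[OF Vc Sc Uc, of f] unfolding eq S_adj .
  hence "U * S n m g = U * (dq.adj U * (S n m f * V))"
    unfolding assoc_mult_mat[OF dq.adj_carrier[OF Uc] Sc Vc, symmetric] by simp
  also have "\<dots> = S n m f * V"
    by (rule dq_unitary_cancel[OF U mult_carrier_mat[OF Sc Vc]])
  finally have eq2: "U * S n m g = S n m f * V" .
  have e1: "(if j < m then V $$ (i, j) * dq_of_dual (g j) else 0) = dq_of_dual (f i) * U $$ (i, j)"
    if "i < m"
    using arg_cong[OF eq1, of "\<lambda>M. M $$ (i, j)"] that ij
    unfolding S_def mult_diag_rect_index[OF Vc that ij(2)] diag_rect_mult_index[OF Uc that ij(2)] by simp
  have e2: "U $$ (i, j) * dq_of_dual (g j) = (if i < m then dq_of_dual (f i) * V $$ (i, j) else 0)"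
    if "j < m"
    using arg_cong[OF eq2, of "\<lambda>M. M $$ (i, j)"] that ij
    unfolding S_def mult_diag_rect_index[OF Uc ij(1) that] diag_rect_mult_index[OF Vc ij(1) that] by simp
  have dq0: "dq_of_dual 0 = 0" by (simp add: dual_eq_iff)
  consider "i < m" "j < m" | "i < m" "m \<le> j" | "m \<le> i" "j < m" | "m \<le> i" "m \<le> j" by linarith
  thus ?thesis
  proof cases
    case 1
    thus ?thesis using dq_intertwine_pair[OF _ _ f(1) g(1) nz] e1 e2 by simp
  next
    case 2
    have "U $$ (i, j) * dq_of_dual 0 = dq_of_dual (f i) * U $$ (i, j)" using e1 2 by (simp add: dq0)
    hence "0 = f i" by (rule dq_intertwine_real[OF _ nz])
    thus ?thesis using g(2)[of j] 2 by simp
  next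
    case 3
    have "U $$ (i, j) * dq_of_dual (g j) = dq_of_dual 0 * U $$ (i, j)" using e2 3 by (simp add: dq0)
    hence "g j = 0" by (rule dq_intertwine_real[OF _ nz])
    thus ?thesis using f(2)[of i] 3 by simp
  next
    case 4
    thus ?thesis using f(2)[of i] g(2)[of j] by simp
  qed
qed

text \<open>The squared norms of the entries of a unitary matrix form a doubly stochastic matrix.\<close>

lemma quat_unitary_level_sets:
  assumes U: "quat.unitary n U"
    and fg: "\<And>i j. i < n \<Longrightarrow> j < n \<Longrightarrow> U $$ (i, j) \<noteq> 0 \<Longrightarrow> f i = g j"
  shows "card {i. i < n \<and> f i = x} = card {j. j < n \<and> g j = x}"
proof -
  note c = quat.unitary_carrier[OF U]
  have col: "(\<Sum>i<n. qnorm2 (U $$ (i, j))) = 1" if "j < n" for j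
  proof -
    have "of_real (\<Sum>i<n. qnorm2 (U $$ (i, j))) = (1 :: quat)"
      using quat.unitary_sum[OF U that that] by (simp add: quat_cnj_mult_self)
    thus ?thesis using of_real_eq_1_iff by blast
  qed
  have row: "(\<Sum>j<n. qnorm2 (U $$ (i, j))) = 1" if "i < n" for i
  proof -
    have "of_real (\<Sum>j<n. qnorm2 (U $$ (i, j))) = (1 :: quat)"
      using quat.unitary_sum[OF quat_unitary_adj[OF U] that that] that c by (simp add: quat_cnj_mult_self)
    thus ?thesis using of_real_eq_1_iff by blast
  qed
  let ?I = "{i. i < n \<and> f i = x}" and ?J = "{j. j < n \<and> g j = x}"
  have "real (card ?I) = (\<Sum>i\<in>?I. \<Sum>j<n. qnorm2 (U $$ (i, j)))" by (simp add: row)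
  also have "\<dots> = (\<Sum>i\<in>?I. \<Sum>j\<in>?J. qnorm2 (U $$ (i, j)))"
    using fg by (intro sum.cong refl sum.mono_neutral_right) auto
  also have "\<dots> = (\<Sum>j\<in>?J. \<Sum>i\<in>?I. qnorm2 (U $$ (i, j)))" by (rule sum.swap)
  also have "\<dots> = (\<Sum>j\<in>?J. \<Sum>i<n. qnorm2 (U $$ (i, j)))"
    using fg by (intro sum.cong refl sum.mono_neutral_left) auto
  also have "\<dots> = real (card ?J)" by (simp add: col)
  finally show ?thesis by simp
qed

lemma antitone_eq_if_level_sets_eq:
  fixes f g :: "nat \<Rightarrow> 'a :: linorder"
  assumes f: "\<And>i j. i \<le> j \<Longrightarrow> j < n \<Longrightarrow> f j \<le> f i" and g: "\<And>i j. i \<le> j \<Longrightarrow> j < n \<Longrightarrow> g j \<le> g i"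
    and card: "\<And>x. card {i. i < n \<and> f i = x} = card {i. i < n \<and> g i = x}"
    and i: "i < n"
  shows "f i = g i"
proof -
  have count: "count (mset (map h [0..<n])) x = card {i. i < n \<and> h i = x}" for h :: "nat \<Rightarrow> 'a" and x
  proof -
    have "count (mset (map h [0..<n])) x = (\<Sum>i\<in>h -` {x} \<inter> {0..<n}. 1)"
      by (simp add: count_image_mset)
    also have "h -` {x} \<inter> {0..<n} = {i. i < n \<and> h i = x}" by auto
    finally show ?thesis by simp
  qed
  have "mset (map f [0..<n]) = mset (map g [0..<n])"
    by (rule multiset_eqI) (simp only: count card)
  hence "mset (rev (map f [0..<n])) = mset (rev (map g [0..<n]))" by simp
  moreover have "sorted (rev (map f [0..<n]))" "sorted (rev (map g [0..<n]))"
    using f g by (auto simp: sorted_rev_iff_nth_mono)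
  ultimately have "rev (map f [0..<n]) = rev (map g [0..<n])"
    by (metis properties_for_sort)
  thus ?thesis using i by simp
qed

lemma initial_segment:
  fixes p :: nat
  assumes "\<And>i j. i \<le> j \<Longrightarrow> j < p \<Longrightarrow> Q j \<Longrightarrow> Q i"
  obtains t where "t \<le> p" "\<And>i. i < p \<Longrightarrow> Q i \<longleftrightarrow> i < t"
proof -
  have "\<exists>t\<le>p. \<forall>i<p. Q i \<longleftrightarrow> i < t"
    using assms
  proof (induction p)
    case (Suc p)
    show ?case
    proof (cases "Q p")
      case True
      thus ?thesis using Suc.prems[of _ p] by (intro exI[of _ "Suc p"]) auto
    next
      case False
      obtain t where t: "t \<le> p" "\<forall>i<p. Q i \<longleftrightarrow> i < t" using Suc by (meson less_SucI)
      thus ?thesis using False by (intro exI[of _ t]) (auto simp: less_Suc_eq)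
    qed
  qed simp
  thus thesis using that by blast
qed

lemma antitone_rearrangement:
  fixes f :: "nat \<Rightarrow> 'a :: linorder"
  obtains \<pi> where "\<pi> permutes {..<p}" "\<And>i j. i \<le> j \<Longrightarrow> j < p \<Longrightarrow> f (\<pi> j) \<le> f (\<pi> i)"
proof -
  let ?xs = "map f [0..<p]"
  define ys where "ys = rev (sort ?xs)"
  have "mset ys = mset ?xs" by (simp add: ys_def)
  then obtain \<pi> where \<pi>: "\<pi> permutes {..<length ?xs}" "permute_list \<pi> ?xs = ys"
    by (rule mset_eq_permutation)
  have nth: "ys ! i = f (\<pi> i)" if "i < p" for i
    using that permute_list_nth[OF \<pi>(1), of i] permutes_in_image[OF \<pi>(1), of i] \<pi>(2) by simp
  have "sorted (rev ys)" by (simp add: ys_def)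
  moreover have "length ys = p" by (simp add: ys_def)
  ultimately have "f (\<pi> j) \<le> f (\<pi> i)" if "i \<le> j" "j < p" for i j
    using that nth by (auto simp: sorted_rev_iff_nth_mono)
  thus thesis using that \<pi>(1) by simp
qed

lemma sigma_block_eq_diag_rect:
  assumes "t \<le> min m n"
  shows "sigma_block m n t \<mu> = diag_rect m n (\<lambda>i. dq_of_dual (if i < t then \<mu> i else 0))"
proof -
  have "dq_of_dual 0 = 0" by (simp add: dual_eq_iff)
  thus ?thesis using assms
    by (intro eq_matI) (auto simp: sigma_block_def mat_diag_def)
qed

lemma singular_value_form_exists:
  assumes B: "B \<in> carrier_mat m n" and B0: "map_mat st_part B \<noteq> 0\<^sub>m m n"
  shows "\<exists>V U r t \<mu>. 1 \<le> r \<and> singular_value_form B V U r t \<mu>"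
proof (rule dq_svd_unordered[OF B])
  fix V U \<nu> assume V: "dq.unitary m V" and U: "dq.unitary n U"
    and S: "dq.adj V * B * U = diag_rect m n (\<lambda>i. dq_of_dual (\<nu> i))"
    and \<nu>: "\<And>i. i < min m n \<Longrightarrow> 0 \<le> \<nu> i"
  note Vc = dq.unitary_carrier[OF V] and Uc = dq.unitary_carrier[OF U]
  let ?p = "min m n"
  obtain \<pi> where \<pi>: "\<pi> permutes {..<?p}"
    and anti: "\<And>i j. i \<le> j \<Longrightarrow> j < ?p \<Longrightarrow> \<nu> (\<pi> j) \<le> \<nu> (\<pi> i)"
    by (rule antitone_rearrangement[of ?p \<nu>]) blast
  have \<pi>m: "\<pi> permutes {..<m}" and \<pi>n: "\<pi> permutes {..<n}"
    using permutes_subset[OF \<pi>] by auto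
  define \<mu> where "\<mu> i = \<nu> (\<pi> i)" for i
  have \<mu>: "0 \<le> \<mu> i" if "i < ?p" for i
    using \<nu>[of "\<pi> i"] permutes_in_image[OF \<pi>, of i] that by (simp add: \<mu>_def)
  have \<mu>_anti: "\<mu> j \<le> \<mu> i" if "i \<le> j" "j < ?p" for i j using anti that by (simp add: \<mu>_def)
  obtain t where t: "t \<le> ?p" "\<And>i. i < ?p \<Longrightarrow> 0 < \<mu> i \<longleftrightarrow> i < t"
    using initial_segment[of ?p "\<lambda>i. 0 < \<mu> i"] \<mu>_anti by (metis less_le_trans)
  obtain r where r: "r \<le> ?p" "\<And>i. i < ?p \<Longrightarrow> 0 < st_part (\<mu> i) \<longleftrightarrow> i < r"
  proof (rule initial_segment[of ?p "\<lambda>i. 0 < st_part (\<mu> i)"])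
    fix i j assume "i \<le> j" "j < ?p" "0 < st_part (\<mu> j)"
    thus "0 < st_part (\<mu> i)" using \<mu>_anti[of i j] by (auto simp: less_eq_dual_def)
  qed blast
  have st_nonneg: "0 \<le> st_part (\<mu> i)" if "i < ?p" for i
    using \<mu>[OF that] by (auto simp: less_eq_dual_def)
  have rt: "r \<le> t"
  proof (rule ccontr)
    assume "\<not> r \<le> t"
    hence "t < r" "t < ?p" using r(1) by auto
    hence "0 < st_part (\<mu> t)" "\<not> 0 < \<mu> t" using t(2) r(2) by auto
    thus False by (simp add: less_dual_def)
  qed
  define Pm Pn :: "quat dual mat"
    where "Pm = mat m m (\<lambda>(i, j). if i = \<pi> j then 1 else 0)"
      and "Pn = mat n n (\<lambda>(i, j). if i = \<pi> j then 1 else 0)"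
  have Pm: "dq.unitary m Pm" and Pn: "dq.unitary n Pn"
    unfolding Pm_def Pn_def by (rule dq.perm_mat_unitary, fact)+
  note Pmc = dq.unitary_carrier[OF Pm] and Pnc = dq.unitary_carrier[OF Pn]
  have form: "dq.adj (V * Pm) * B * (U * Pn) = sigma_block m n t \<mu>"
    unfolding dq.conj_mult_mult[OF Vc Pmc B Uc Pnc] S sigma_block_eq_diag_rect[OF t(1)]
  proof (rule eq_matI)
    fix i j
    assume "i < dim_row (diag_rect m n (\<lambda>i. dq_of_dual (if i < t then \<mu> i else 0)))"
      "j < dim_col (diag_rect m n (\<lambda>i. dq_of_dual (if i < t then \<mu> i else 0)))"
    hence ij: "i < m" "j < n" by simp_all
    have \<pi>ij: "\<pi> i < m" "\<pi> j < n" "\<pi> i = \<pi> j \<longleftrightarrow> i = j"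
      using permutes_in_image[OF \<pi>m, of i] permutes_in_image[OF \<pi>n, of j] ij
        permutes_inj[OF \<pi>] by (auto dest: injD)
    have z: "\<mu> i = 0" if "i = j" "\<not> i < t"
    proof -
      have "i < ?p" using that ij by simp
      hence "\<not> 0 < \<mu> i" "0 \<le> \<mu> i" using t(2) \<mu> that by blast+
      thus ?thesis by (metis antisym not_less)
    qed
    show "(dq.adj Pm * diag_rect m n (\<lambda>i. dq_of_dual (\<nu> i)) * Pn) $$ (i, j)
      = diag_rect m n (\<lambda>i. dq_of_dual (if i < t then \<mu> i else 0)) $$ (i, j)"
      unfolding Pm_def Pn_def dq.conj_perm_mat[OF \<pi>m \<pi>n diag_rect_carrier ij]
      using ij \<pi>ij z by (auto simp: \<mu>_def)
  qed (use Pmc Pnc in auto)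
  have r1: "1 \<le> r"
  proof (rule ccontr)
    assume "\<not> 1 \<le> r"
    hence st0: "st_part (\<mu> i) = 0" if "i < ?p" for i
      using r(2)[OF that] st_nonneg[OF that] by simp
    define A where "A = map_mat st_part B"
    have Ac: "A \<in> carrier_mat m n" using B by (simp add: A_def)
    define V0 U0 where "V0 = map_mat st_part (V * Pm)" and "U0 = map_mat st_part (U * Pn)"
    have VP: "dq.unitary m (V * Pm)" and UP: "dq.unitary n (U * Pn)"
      by (intro dq.unitary_mult V Pm U Pn)+
    note VPc = dq.unitary_carrier[OF VP] and UPc = dq.unitary_carrier[OF UP]
    have V0: "quat.unitary m V0" and U0: "quat.unitary n U0"
      unfolding V0_def U0_def by (intro quat_unitary_st_part VP UP)+
    note V0c = quat.unitary_carrier[OF V0] and U0c = quat.unitary_carrier[OF U0]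
    have VBc: "dq.adj (V * Pm) * B \<in> carrier_mat m n"
      by (rule mult_carrier_mat[OF dq.adj_carrier[OF VPc] B])
    have "quat.adj V0 * A * U0 = map_mat st_part (sigma_block m n t \<mu>)"
      unfolding form[symmetric] st_part_mult_mat[OF VBc UPc]
        st_part_mult_mat[OF dq.adj_carrier[OF VPc] B] st_part_adj V0_def U0_def A_def ..
    also have "\<dots> = 0\<^sub>m m n"
      unfolding sigma_block_eq_diag_rect[OF t(1)] using st0 t(1) by (intro eq_matI) auto
    finally have "quat.adj V0 * (A * U0) = 0\<^sub>m m n"
      using assoc_mult_mat[OF quat.adj_carrier[OF V0c] Ac U0c] by simp
    hence "A * U0 = 0\<^sub>m m n"
      using quat_unitary_cancel[OF V0 mult_carrier_mat[OF Ac U0c]] V0c by simp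
    moreover have "A * U0 * quat.adj U0 = A"
      using assoc_mult_mat[OF Ac U0c quat.adj_carrier[OF U0c]] quat_unitary_adj[OF U0] Ac
      by (simp add: quat.unitary_def)
    ultimately have "A = 0\<^sub>m m n" using U0c by simp
    thus False using B0 by (simp add: A_def)
  qed
  have "singular_value_form B (V * Pm) (U * Pn) r t \<mu>"
    unfolding singular_value_form_def dq_unitary_eq dq_adjoint_eq carrier_matD[OF B]
  proof (intro conjI allI impI)
    show "dq.unitary m (V * Pm)" "dq.unitary n (U * Pn)" by (intro dq.unitary_mult V Pm U Pn)+
    show "dq.adj (V * Pm) * B * (U * Pn) = sigma_block m n t \<mu>" by (rule form)
    show "r \<le> t" "t \<le> min m n" by fact+
    show "0 < \<mu> i" if "i < r" for i using that r(1) rt t(2)[of i] by auto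
    show "appreciable (\<mu> i)" if "i < r" for i
      using that r(1) r(2)[of i] by (auto simp: appreciable_def)
    show "\<mu> j \<le> \<mu> i" if "i \<le> j \<and> j < r" for i j using that r(1) \<mu>_anti by simp
    show "0 < \<mu> i" if "r \<le> i \<and> i < t" for i using that t(1) t(2)[of i] by auto
    show "infinitesimal (\<mu> i)" if "r \<le> i \<and> i < t" for i
      using that t(1) r(2)[of i] st_nonneg[of i] by (auto simp: infinitesimal_def)
    show "\<mu> j \<le> \<mu> i" if "r \<le> i \<and> i \<le> j \<and> j < t" for i j using that t(1) \<mu>_anti by simp
  qed
  thus ?thesis using r1 by blast
qed

lemma singular_value_form_unique:
  assumes B: "B \<in> carrier_mat m n"
    and F: "singular_value_form B V U r t \<mu>" and F': "singular_value_form B V' U' r' t' \<mu>'"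
  shows "r = r' \<and> t = t' \<and> mat_diag t \<mu> = mat_diag t' \<mu>'"
proof -
  define pad where "pad t \<mu> i = (if i < t then \<mu> i else 0)" for t and \<mu> :: "nat \<Rightarrow> real dual" and i :: nat
  have facts: "dq.unitary m V" "dq.unitary n U"
      "dq.adj V * B * U = diag_rect m n (\<lambda>i. dq_of_dual (pad t \<mu> i))"
      "\<And>i. 0 \<le> pad t \<mu> i" "\<And>i. min m n \<le> i \<Longrightarrow> pad t \<mu> i = 0"
      "\<And>i j. i \<le> j \<Longrightarrow> pad t \<mu> j \<le> pad t \<mu> i" "\<And>i. 0 < pad t \<mu> i \<longleftrightarrow> i < t"
      "\<And>i. appreciable (pad t \<mu> i) \<longleftrightarrow> i < r"
    if F: "singular_value_form B V U r t \<mu>" for V U r t \<mu>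
  proof -
    note F = F[unfolded singular_value_form_def dq_unitary_eq dq_adjoint_eq carrier_matD[OF B]]
    have app: "0 < \<mu> i" "appreciable (\<mu> i)" if "i < r" for i using F that by blast+
    have inf: "0 < \<mu> i" "infinitesimal (\<mu> i)" if "r \<le> i" "i < t" for i using F that by blast+
    have anti: "\<mu> j \<le> \<mu> i" if "i \<le> j" "j < r \<or> r \<le> i \<and> j < t" for i j using F that by blast
    have rt: "r \<le> t" "t \<le> min m n" using F by blast+
    have pos: "0 < \<mu> i" if "i < t" for i using app inf that by (cases "i < r") auto
    have mid: "\<mu> j \<le> \<mu> i" if "i < r" "r \<le> j" "j < t" for i j
      using app[OF that(1)] inf[OF that(2,3)]
      by (auto simp: less_dual_def less_eq_dual_def appreciable_def infinitesimal_def)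
    show "dq.unitary m V" "dq.unitary n U" using F by blast+
    show "dq.adj V * B * U = diag_rect m n (\<lambda>i. dq_of_dual (pad t \<mu> i))"
      using F sigma_block_eq_diag_rect[OF rt(2), of \<mu>] by (simp add: pad_def)
    show "0 \<le> pad t \<mu> i" for i using pos[of i] by (simp add: pad_def less_imp_le)
    show "pad t \<mu> i = 0" if "min m n \<le> i" for i
    proof -
      have "\<not> i < t" using that rt(2) by linarith
      thus ?thesis by (simp add: pad_def)
    qed
    show "0 < pad t \<mu> i \<longleftrightarrow> i < t" for i using pos[of i] by (simp add: pad_def)
    show "pad t \<mu> j \<le> pad t \<mu> i" if "i \<le> j" for i j
    proof (cases "j < t")
      case True
      hence "\<mu> j \<le> \<mu> i" using that anti mid by (metis not_le)
      thus ?thesis using True that by (simp add: pad_def)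
    next
      case False
      thus ?thesis using pos by (auto simp: pad_def less_imp_le)
    qed
    show "appreciable (pad t \<mu> i) \<longleftrightarrow> i < r" for i
      using app[of i] inf[of i] rt by (cases "i < r"; cases "i < t")
        (auto simp: pad_def appreciable_def infinitesimal_def)
  qed
  have V: "dq.unitary m V" and U: "dq.unitary n U" and V': "dq.unitary m V'" and U': "dq.unitary n U'"
    by (fact facts(1,2)[OF F] facts(1,2)[OF F'])+
  note c = V[THEN dq.unitary_carrier] U[THEN dq.unitary_carrier]
    V'[THEN dq.unitary_carrier] U'[THEN dq.unitary_carrier]
  define X Y where "X = dq.adj V * V'" and "Y = dq.adj U * U'"
  have X: "dq.unitary m X" and Y: "dq.unitary n Y"
    unfolding X_def Y_def by (intro dq.unitary_mult dq_unitary_adj V U V' U')+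
  have VX: "V * X = V'" and UY: "U * Y = U'"
    unfolding X_def Y_def using dq_unitary_cancel[OF V c(3)] dq_unitary_cancel[OF U c(4)] by simp_all
  have "dq.adj X * (dq.adj V * B * U) * Y = dq.adj V' * B * U'"
    using dq.conj_mult_mult[OF c(1) dq.unitary_carrier[OF X] B c(2) dq.unitary_carrier[OF Y]]
    unfolding VX UY by simp
  hence eq: "dq.adj X * diag_rect m n (\<lambda>i. dq_of_dual (pad t \<mu> i)) * Y
      = diag_rect m n (\<lambda>i. dq_of_dual (pad t' \<mu>' i))"
    unfolding facts(3)[OF F] facts(3)[OF F'] .
  note f = facts(4,5)[OF F] and g = facts(4,5)[OF F']
  have card: "card {i. i < n \<and> pad t \<mu> i = x} = card {i. i < n \<and> pad t' \<mu>' i = x}" for x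
  proof (rule quat_unitary_level_sets[OF quat_unitary_st_part[OF Y]])
    fix i j assume "i < n" "j < n" "map_mat st_part Y $$ (i, j) \<noteq> 0"
    thus "pad t \<mu> i = pad t' \<mu>' j"
      using diag_rect_unitary_equiv[OF X Y eq f g] dq.unitary_carrier[OF Y] by simp
  qed
  have padeq: "pad t \<mu> i = pad t' \<mu>' i" for i
  proof (cases "i < n")
    case True
    show ?thesis
      by (rule antitone_eq_if_level_sets_eq[OF _ _ card True]) (rule facts(6)[OF F] facts(6)[OF F'], assumption)+
  next
    case False
    thus ?thesis using f(2)[of i] g(2)[of i] by simp
  qed
  have "i < t \<longleftrightarrow> i < t'" "i < r \<longleftrightarrow> i < r'" for i
    using facts(7,8)[OF F, of i] facts(7,8)[OF F', of i] by (simp_all add: padeq)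
  hence tr: "t = t'" "r = r'" by (metis linorder_neqE_nat less_irrefl)+
  have "\<mu> i = \<mu>' i" if "i < t" for i using padeq[of i] that tr by (simp add: pad_def)
  hence "mat_diag t \<mu> = mat_diag t' \<mu>'" using tr by (intro eq_matI) (auto simp: mat_diag_def)
  thus ?thesis using tr by simp
qed

theorem theorem6p1:
  fixes B :: "quat dual mat" and m n :: nat
  assumes "B \<in> carrier_mat m n"
    and "map_mat st_part B \<noteq> 0\<^sub>m m n"
  shows "(\<exists>V U r t \<mu>. 1 \<le> r \<and> singular_value_form B V U r t \<mu>) \<and>
    (\<forall>V U r t \<mu> V' U' r' t' \<mu>'.
       singular_value_form B V U r t \<mu> \<and> singular_value_form B V' U' r' t' \<mu>' \<longrightarrow>
       r = r' \<and> t = t' \<and> mat_diag t \<mu> = mat_diag t' \<mu>')"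
  using singular_value_form_exists[OF assms] singular_value_form_unique[OF assms(1)] by blast

end
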